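(* Let $d\ge 1$, let $\Lambda(\boldsymbol{B})$ be a $d$-dimensional lattice in $\mathbb{R}^d$ and let $\Lambda(\boldsymbol{A})$ be its dual lattice scaled by $2\pi$, with Voronoi cell $\Omega(\boldsymbol{A})$. Let $\omega_0>0$, $S_0>0$, let $\Delta=\{\boldsymbol{\omega}\in\mathbb{R}^d:\|\boldsymbol{\omega}\|\le\omega_0\}$, and let $X$ be an isotropically bandlimited stationary process on $\mathbb{R}^d$, i.e. one whose power spectral density is $S(\boldsymbol{\omega})=S_0$ for $\boldsymbol{\omega}\in\Delta$ and $S(\boldsymbol{\omega})=0$ for $\boldsymbol{\omega}\notin\Delta$; let $\sigma^2$ be its variance. If $X$ is sampled on the lattice $\Lambda(\boldsymbol{B})$ and reconstructed using the best linear interpolator, then the average reconstruction error variance is $$\sigma_{\mathrm e}^2=\sigma^2\,\frac{\operatorname{vol}\left(\Delta\setminus\Omega(\boldsymbol{A})\right)}{\operatorname{vol}\Delta}.$$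
   Context: Lattices: $\Lambda(\boldsymbol{B})$ denotes the $d$-dimensional (full-rank) lattice generated over $\mathbb{Z}$ by the rows of the generator matrix $\boldsymbol{B}$. The dual lattice scaled by $2\pi$ is $\Lambda(\boldsymbol{A})=\{\boldsymbol{\lambda}\in\mathbb{R}^d:\langle\boldsymbol{\lambda},\boldsymbol{b}\rangle\in 2\pi\mathbb{Z}\text{ for all }\boldsymbol{b}\in\Lambda(\boldsymbol{B})\}$. The Voronoi cell of a lattice $\Lambda$ is $\Omega=\{\boldsymbol{x}\in\mathbb{R}^d:\|\boldsymbol{x}\|\le\|\boldsymbol{x}-\boldsymbol{\lambda}\|\text{ for all }\boldsymbol{\lambda}\in\Lambda\}$; $\Omega(\boldsymbol{A})$ and $\Omega(\boldsymbol{B})$ are the Voronoi cells of $\Lambda(\boldsymbol{A})$ and $\Lambda(\boldsymbol{B})$. $\operatorname{vol}$ is $d$-dimensional Lebesgue measure and $\|\cdot\|$ the Euclidean norm. Process: $X=\{X(\boldsymbol{t})\}_{\boldsymbol{t}\in\mathbb{R}^d}$ is a zero-mean, (wide-sense) stationary, square-integrable stochastic process with power spectral density $S$, meaning $\mathbb{E}[X(\boldsymbol{t}+\boldsymbol{s})\overline{X(\boldsymbol{t})}]=\frac{1}{(2\pi)^d}\int_{\mathbb{R}^d}S(\boldsymbol{\omega})e^{i\langle\boldsymbol{\omega},\boldsymbol{s}\rangle}\,d\boldsymbol{\omega}$. In particular its variance is $\sigma^2=\frac{1}{(2\pi)^d}\int_{\mathbb{R}^d}S(\boldsymbol{\omega})\,d\boldsymbol{\omega}=\frac{S_0}{(2\pi)^d}\operatorname{vol}\Delta$.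 Reconstruction: the best linear interpolator $\hat X(\boldsymbol{t})$ is the linear minimum-mean-square-error estimator of $X(\boldsymbol{t})$ from the samples $\{X(\boldsymbol{b}):\boldsymbol{b}\in\Lambda(\boldsymbol{B})\}$, i.e. the orthogonal projection in $L^2$ of $X(\boldsymbol{t})$ onto the closed linear span of the samples. The average reconstruction error variance is the average over time, which by periodicity is $$\sigma_{\mathrm e}^2=\frac{1}{\operatorname{vol}\Omega(\boldsymbol{B})}\int_{\Omega(\boldsymbol{B})}\mathbb{E}\,|X(\boldsymbol{t})-\hat X(\boldsymbol{t})|^2\,d\boldsymbol{t}.$$ *)

theory Defs
  imports "HOL-Probability.Probability"
begin

definition lattice_of :: "real^'n^'n \<Rightarrow> (real^'n) set" where
  "lattice_of B = {\<Sum>i\<in>UNIV. of_int (k i) *\<^sub>R row i B | k :: 'n \<Rightarrow> int. True}"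

definition scaled_dual :: "(real^'n) set \<Rightarrow> (real^'n) set" where
  "scaled_dual L = {l. \<forall>b\<in>L. \<exists>k::int. l \<bullet> b = 2 * pi * of_int k}"

definition voronoi_cell :: "(real^'n) set \<Rightarrow> (real^'n) set" where
  "voronoi_cell L = {x. \<forall>l\<in>L. norm x \<le> norm (x - l)}"

text \<open>Processes are complex valued. Random variables are represented by functions rather than by
  almost-everywhere equivalence classes.\<close>

definition square_integrable :: "'a measure \<Rightarrow> ('a \<Rightarrow> complex) \<Rightarrow> bool" where
  "square_integrable M Z \<longleftrightarrow> Z \<in> borel_measurable M \<and> integrable M (\<lambda>w. (cmod (Z w))\<^sup>2)"

definition L2_dist :: "'a measure \<Rightarrow> ('a \<Rightarrow> complex) \<Rightarrow> ('a \<Rightarrow> complex) \<Rightarrow> real" where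
  "L2_dist M Y Z = sqrt (\<integral>w. (cmod (Y w - Z w))\<^sup>2 \<partial>M)"

definition L2_inner :: "'a measure \<Rightarrow> ('a \<Rightarrow> complex) \<Rightarrow> ('a \<Rightarrow> complex) \<Rightarrow> complex" where
  "L2_inner M Y Z = (\<integral>w. Y w * cnj (Z w) \<partial>M)"

definition complex_variance :: "'a measure \<Rightarrow> ('a \<Rightarrow> complex) \<Rightarrow> real" where
  "complex_variance M Z = (\<integral>w. (cmod (Z w - (\<integral>v. Z v \<partial>M)))\<^sup>2 \<partial>M)"

definition zero_mean :: "'a measure \<Rightarrow> ('t \<Rightarrow> 'a \<Rightarrow> complex) \<Rightarrow> bool" where
  "zero_mean M X \<longleftrightarrow> (\<forall>t. (\<integral>w. X t w \<partial>M) = 0)"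

definition wide_sense_stationary ::
    "'a measure \<Rightarrow> (real^'n \<Rightarrow> 'a \<Rightarrow> complex) \<Rightarrow> bool" where
  "wide_sense_stationary M X \<longleftrightarrow>
     (\<forall>t u. (\<integral>w. X t w \<partial>M) = (\<integral>w. X u w \<partial>M)) \<and>
     (\<forall>s t u. L2_inner M (X (t + s)) (X t) = L2_inner M (X (u + s)) (X u))"

text \<open>For zero-mean processes the correlation below is the covariance.\<close>

definition has_power_spectral_density ::
    "'a measure \<Rightarrow> (real^'n \<Rightarrow> 'a \<Rightarrow> complex) \<Rightarrow> (real^'n \<Rightarrow> real) \<Rightarrow> bool" where
  "has_power_spectral_density M X S \<longleftrightarrow>
     (\<forall>\<omega>. 0 \<le> S \<omega>) \<and> integrable lborel S \<and>
     (\<forall>t s. L2_inner M (X (t + s)) (X t) =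
        of_real (1 / (2 * pi) ^ CARD('n)) *
        (\<integral>\<omega>. of_real (S \<omega>) * exp (\<i> * of_real (\<omega> \<bullet> s)) \<partial>lborel))"

definition finite_combinations :: "('t \<Rightarrow> 'a \<Rightarrow> complex) \<Rightarrow> 't set \<Rightarrow> ('a \<Rightarrow> complex) set" where
  "finite_combinations X T = {\<lambda>w. \<Sum>b\<in>F. c b * X b w | F c. finite F \<and> F \<subseteq> T}"

definition closed_linear_span ::
    "'a measure \<Rightarrow> ('t \<Rightarrow> 'a \<Rightarrow> complex) \<Rightarrow> 't set \<Rightarrow> ('a \<Rightarrow> complex) set" where
  "closed_linear_span M X T =
     {Z. square_integrable M Z \<and> (\<forall>e>0. \<exists>Y\<in>finite_combinations X T. L2_dist M Z Y < e)}"

definition is_orthogonal_projection ::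
    "'a measure \<Rightarrow> ('a \<Rightarrow> complex) set \<Rightarrow> ('a \<Rightarrow> complex) \<Rightarrow> ('a \<Rightarrow> complex) \<Rightarrow> bool" where
  "is_orthogonal_projection M V Z P \<longleftrightarrow>
     P \<in> V \<and> (\<forall>Y\<in>V. L2_inner M (\<lambda>w. Z w - P w) Y = 0)"

text \<open>Orthogonal projections are unique only up to almost-everywhere equality, so the interpolator
  is characterised by a predicate.\<close>

definition best_linear_interpolator ::
    "'a measure \<Rightarrow> ('t \<Rightarrow> 'a \<Rightarrow> complex) \<Rightarrow> 't set \<Rightarrow> ('t \<Rightarrow> 'a \<Rightarrow> complex) \<Rightarrow> bool" where
  "best_linear_interpolator M X T Xhat \<longleftrightarrow>
     (\<forall>t. is_orthogonal_projection M (closed_linear_span M X T) (X t) (Xhat t))"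

definition average_error_variance ::
    "'a measure \<Rightarrow> (real^'n) set \<Rightarrow> (real^'n \<Rightarrow> 'a \<Rightarrow> complex) \<Rightarrow> (real^'n \<Rightarrow> 'a \<Rightarrow> complex) \<Rightarrow> real" where
  "average_error_variance M L X Xhat =
     (1 / measure lebesgue (voronoi_cell L)) *
     (LINT t:voronoi_cell L|lebesgue. (\<integral>w. (cmod (X t w - Xhat t w))\<^sup>2 \<partial>M))"

end

theory Submission
  imports Defs
begin

text \<open>
  By the spectral representation, approximating \<open>X t\<close> by finite combinations of samples amounts to
  approximating \<open>cis (\<omega> \<bullet> t)\<close> in \<open>L\<^sup>2(\<Delta>)\<close> by trigonometric polynomials with frequencies in
  \<open>\<Lambda>(B)\<close>, which are \<open>\<Lambda>(A)\<close>-periodic. Fold \<open>\<Delta>\<close> into the Voronoi cell \<open>\<Omega>(A)\<close>: over \<open>x\<close> lie \<open>n\<close>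
  points \<open>x + \<lambda>\<close> of \<open>\<Delta>\<close>, and the best periodic approximation there is the mean of the \<open>n\<close> values
  \<open>cis ((x + \<lambda>) \<bullet> t)\<close>, with squared error \<open>n - \<bar>\<Sum> cis (\<lambda> \<bullet> t)\<bar>\<^sup>2 / n\<close>. By density of trigonometric
  polynomials in \<open>L\<^sup>2(\<Omega>(A))\<close> this error is attained in the limit. By orthogonality of the
  characters its average over \<open>t\<close> in \<open>\<Omega>(B)\<close> is \<open>n - 1\<close> where \<open>n > 0\<close>. Finally \<open>n\<close> integrates to
  \<open>vol \<Delta>\<close>, and \<open>n > 0\<close> holds exactly on \<open>\<Omega>(A) \<inter> \<Delta>\<close>, because points of the Voronoi cell are the
  shortest in their coset.
\<close>

section \<open>Lattices and fundamental domains\<close>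

text \<open>Folding and error estimates are carried out with nonnegative extended integrals, so that
  Tonelli and translations need no integrability argument; in return, differences have to be recast
  as sums with finite summands to cancel. The closed cells of the tiling share boundary points, so
  coset representatives are unique only almost everywhere, which integrals do not notice. The mean
  over the aliases may jump where an alias enters or leaves the ball; density is therefore needed
  for bounded Borel functions, and it is reached from Stone-Weierstrass on a torus by way of
  indicators of compact sets. Both lattices tile a space, \<open>\<Lambda>(A)\<close> that of
  frequencies and \<open>\<Lambda>(B)\<close> that of times, so facts about cells are proved once
  for an abstract lattice. The interpolator is known only through orthogonality and membership in a
  closure: its error is squeezed between errors of finite sample combinations and never computed
  from a formula for the interpolator.\<close>

lemma nn_integral_shift:
  fixes f :: "real^'n \<Rightarrow> ennreal"
  assumes [measurable]: "f \<in> borel_measurable borel"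
  shows "(\<integral>\<^sup>+x. f (x + a) \<partial>lborel) = (\<integral>\<^sup>+x. f x \<partial>lborel)"
proof -
  have "(\<integral>\<^sup>+x. f x \<partial>lborel) = (\<integral>\<^sup>+x. f x \<partial>distr lborel borel ((+) a))"
    by (simp add: lborel_distr_plus)
  also have "\<dots> = (\<integral>\<^sup>+x. f (x + a) \<partial>lborel)"
    by (subst nn_integral_distr) (auto simp: add.commute)
  finally show ?thesis by simp
qed

text \<open>A basis-free form: discreteness yields countability and shortest coset members, the
  covering radius bounds the Voronoi cell. It thus fits the dual lattice, which is given by
  divisibility conditions instead of generators.\<close>

locale full_lattice =
  fixes L :: "(real^'n) set"
  assumes zero_mem: "0 \<in> L"
    and diff_mem: "x \<in> L \<Longrightarrow> y \<in> L \<Longrightarrow> x - y \<in> L"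
    and finite_Int_cball: "finite (L \<inter> cball 0 r)"
    and covering_radius: "\<exists>R. \<forall>x. \<exists>l\<in>L. norm (x - l) \<le> R"
begin

abbreviation "\<Omega> \<equiv> voronoi_cell L"

lemma uminus_mem: "x \<in> L \<Longrightarrow> - x \<in> L"
  using diff_mem[of 0 x] zero_mem by simp

lemma add_mem: "x \<in> L \<Longrightarrow> y \<in> L \<Longrightarrow> x + y \<in> L"
  using diff_mem[of x "- y"] uminus_mem by simp

lemma countable_lattice: "countable L"
proof -
  have "L = (\<Union>k::nat. L \<inter> cball 0 (real k))"
    by (auto simp: real_arch_simple)
  moreover have "countable (\<Union>k::nat. L \<inter> cball 0 (real k))"
    by (rule countable_UN[OF _ countable_finite[OF finite_Int_cball]]) auto
  ultimately show ?thesis by simp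
qed

lemma closed_voronoi: "closed \<Omega>"
proof -
  have "\<Omega> = (\<Inter>l\<in>L. {x. norm x \<le> norm (x - l)})"
    by (auto simp: voronoi_cell_def)
  then show ?thesis
    by (auto intro!: closed_INT closed_Collect_le continuous_intros)
qed

lemma borel_voronoi [measurable]: "\<Omega> \<in> sets borel"
  using closed_voronoi by (rule borel_closed)

lemma bounded_voronoi: "bounded \<Omega>"
proof -
  obtain R where R: "\<And>x. \<exists>l\<in>L. norm (x - l) \<le> R"
    using covering_radius by blast
  have "norm x \<le> R" if "x \<in> \<Omega>" for x
    using R[of x] that by (force simp: voronoi_cell_def)
  then show ?thesis by (auto simp: bounded_iff)
qed

lemma finite_measure_voronoi: "emeasure lborel \<Omega> < \<infinity>"
  using bounded_voronoi emeasure_bounded_finite by blast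

text \<open>A shortest element of the coset of \<open>x\<close> lies in the cell. It exists because
  a lattice point longer than \<open>2 * norm x\<close> moves \<open>x\<close> further out than 0
  does, which leaves finitely many candidates.\<close>

lemma voronoi_covers: "\<exists>l\<in>L. x + l \<in> \<Omega>"
proof -
  let ?S = "L \<inter> cball 0 (2 * norm x)"
  have "0 \<in> ?S" using zero_mem by auto
  then obtain l where l: "l \<in> ?S" and min: "\<And>m. m \<in> ?S \<Longrightarrow> norm (x + l) \<le> norm (x + m)"
    using ex_is_arg_min_if_finite[OF finite_Int_cball, of "2 * norm x" "\<lambda>m. norm (x + m)"]
    unfolding is_arg_min_linorder by blast
  have "norm (x + l) \<le> norm (x + m)" if "m \<in> L" for m
  proof (cases "m \<in> ?S")
    case False
    then have "2 * norm x < norm m" using that by auto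
    moreover have "norm m \<le> norm (x + m) + norm x"
      using norm_triangle_ineq4[of "x + m" x] by simp
    moreover have "norm (x + l) \<le> norm x" using min[OF \<open>0 \<in> ?S\<close>] by simp
    ultimately show ?thesis by linarith
  qed (rule min)
  then have "x + l \<in> \<Omega>"
    using l diff_mem[of l] by (auto simp: voronoi_cell_def add_diff_eq[symmetric])
  then show ?thesis using l by blast
qed

text \<open>Uniqueness is asked only almost everywhere, since a boundary point of the closed Voronoi
  cell can have several representatives.\<close>

definition fundamental_domain :: "(real^'n) set \<Rightarrow> bool" where
  "fundamental_domain F \<longleftrightarrow> F \<in> sets borel \<and> (AE x in lborel. \<exists>!l. l \<in> L \<and> x + l \<in> F)"

text \<open>If \<open>x + l\<close> and \<open>x + m\<close> both lie in the cell, neither is longer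
  than the other, so \<open>x\<close> is equidistant from \<open>- l\<close> and \<open>- m\<close>.
  For \<open>l \<noteq> m\<close> this is a hyperplane, and countably many hyperplanes form a null
  set.\<close>

lemma fundamental_domain_voronoi: "fundamental_domain \<Omega>"
proof -
  let ?H = "\<lambda>l m. {x. (2 *\<^sub>R (l - m)) \<bullet> x = m \<bullet> m - l \<bullet> l}"
  define N where "N = (\<Union>(l, m) \<in> {p \<in> L \<times> L. fst p \<noteq> snd p}. ?H l m)"
  have "negligible N"
    unfolding N_def
  proof (rule negligible_countable_Union)
    show "countable ((\<lambda>(l, m). ?H l m) ` {p \<in> L \<times> L. fst p \<noteq> snd p})"
      by (intro countable_image countable_Collect countable_SIGMA countable_lattice)
    fix s assume "s \<in> (\<lambda>(l, m). ?H l m) ` {p \<in> L \<times> L. fst p \<noteq> snd p}"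
    then obtain l m where "l \<noteq> m" "s = ?H l m" by auto
    then show "negligible s" using negligible_hyperplane[of "2 *\<^sub>R (l - m)"] by simp
  qed
  then have "AE x in lborel. x \<notin> N"
    by (subst AE_completion_iff[symmetric])
       (auto simp: negligible_iff_null_sets intro: AE_not_in)
  then have "AE x in lborel. \<exists>!l. l \<in> L \<and> x + l \<in> \<Omega>"
  proof (rule AE_mp, intro AE_I2 impI)
    fix x assume x: "x \<notin> N"
    obtain l where l: "l \<in> L" "x + l \<in> \<Omega>" using voronoi_covers by blast
    have "m = l" if m: "m \<in> L" "x + m \<in> \<Omega>" for m
    proof (rule ccontr)
      assume "m \<noteq> l"
      have "norm (x + l) \<le> norm (x + l - (l - m))" "norm (x + m) \<le> norm (x + m - (m - l))"
        using l m diff_mem unfolding voronoi_cell_def by blast+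
      then have "norm (x + l) = norm (x + m)" by simp
      then have "(x + l) \<bullet> (x + l) = (x + m) \<bullet> (x + m)"
        by (simp add: dot_square_norm)
      then have "x \<in> ?H l m"
        by (simp add: inner_commute algebra_simps)
      then show False using x \<open>m \<noteq> l\<close> l m unfolding N_def by auto
    qed
    with l show "\<exists>!l. l \<in> L \<and> x + l \<in> \<Omega>" by blast
  qed
  then show ?thesis by (simp add: fundamental_domain_def)
qed

lemma fundamental_domain_translate:
  assumes "fundamental_domain F"
  shows "fundamental_domain {x. x + a \<in> F}"
proof -
  have [measurable]: "F \<in> sets borel" using assms by (simp add: fundamental_domain_def)
  have "AE x in distr lborel borel ((+) a). \<exists>!l. l \<in> L \<and> x + l \<in> F"
    using assms by (subst lborel_distr_plus) (simp add: fundamental_domain_def)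
  then have "AE x in lborel. \<exists>!l. l \<in> L \<and> (a + x) + l \<in> F"
    by (rule AE_distrD[rotated]) simp
  moreover have "{x. x + a \<in> F} \<in> sets borel"
    by measurable
  ultimately show ?thesis
    by (simp add: fundamental_domain_def add_ac)
qed

text \<open>Almost everywhere 1 equals the number of \<open>l\<close> with \<open>x + l\<close> in
  \<open>F\<close>. Insert this sum, exchange it with the integral, translate each summand by
  \<open>l\<close>, and replace \<open>l\<close> by \<open>- l\<close>.\<close>

lemma nn_integral_fold:
  fixes g :: "real^'n \<Rightarrow> ennreal"
  assumes F: "fundamental_domain F" and [measurable]: "g \<in> borel_measurable borel"
  shows "(\<integral>\<^sup>+x. g x \<partial>lborel)
    = (\<integral>\<^sup>+x. indicator F x * (\<integral>\<^sup>+l. g (x + l) \<partial>count_space L) \<partial>lborel)"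
proof -
  have [measurable]: "F \<in> sets borel" using F by (simp add: fundamental_domain_def)
  have unique: "AE x in lborel. \<exists>!l. l \<in> L \<and> x + l \<in> F"
    using F by (simp add: fundamental_domain_def)
  have "(\<integral>\<^sup>+x. g x \<partial>lborel) = (\<integral>\<^sup>+x. (\<integral>\<^sup>+l. g x * indicator F (x + l) \<partial>count_space L) \<partial>lborel)"
  proof (rule nn_integral_cong_AE, use unique in eventually_elim)
    fix x assume "\<exists>!l. l \<in> L \<and> x + l \<in> F"
    then obtain l where l: "l \<in> L" "x + l \<in> F" and u: "\<And>m. m \<in> L \<Longrightarrow> x + m \<in> F \<Longrightarrow> m = l"
      by blast
    have "(\<integral>\<^sup>+m. g x * indicator F (x + m) \<partial>count_space L)
        = (\<integral>\<^sup>+m. g x * indicator {l} m \<partial>count_space L)"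
      using l(2) by (intro nn_integral_cong) (auto split: split_indicator dest: u)
    also have "\<dots> = g x" using l by (simp add: nn_integral_cmult_indicator)
    finally show "g x = (\<integral>\<^sup>+l. g x * indicator F (x + l) \<partial>count_space L)" by simp
  qed
  also have "\<dots> = (\<integral>\<^sup>+l. (\<integral>\<^sup>+x. g x * indicator F (x + l) \<partial>lborel) \<partial>count_space L)"
    by (intro nn_integral_count_space_nn_integral countable_lattice) measurable
  also have "\<dots> = (\<integral>\<^sup>+l. (\<integral>\<^sup>+x. g (x - l) * indicator F x \<partial>lborel) \<partial>count_space L)"
  proof (rule nn_integral_cong)
    fix l
    show "(\<integral>\<^sup>+x. g x * indicator F (x + l) \<partial>lborel) = (\<integral>\<^sup>+x. g (x - l) * indicator F x \<partial>lborel)"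
      using nn_integral_shift[of "\<lambda>x. g (x - l) * indicator F x" l] by simp
  qed
  also have "\<dots> = (\<integral>\<^sup>+l. (\<integral>\<^sup>+x. g (x + l) * indicator F x \<partial>lborel) \<partial>count_space L)"
  proof -
    have "bij_betw uminus L L"
      by (rule bij_betwI[of _ _ _ uminus]) (auto simp: uminus_mem)
    from nn_integral_bij_count_space[OF this,
        of "\<lambda>l. \<integral>\<^sup>+x. g (x + l) * indicator F x \<partial>lborel"]
    show ?thesis by simp
  qed
  also have "\<dots> = (\<integral>\<^sup>+x. (\<integral>\<^sup>+l. g (x + l) * indicator F x \<partial>count_space L) \<partial>lborel)"
    by (intro nn_integral_count_space_nn_integral[symmetric] countable_lattice) measurable
  also have "\<dots> = (\<integral>\<^sup>+x. indicator F x * (\<integral>\<^sup>+l. g (x + l) \<partial>count_space L) \<partial>lborel)"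
    by (simp add: nn_integral_cmult mult.commute[of _ "indicator F _"])
  finally show ?thesis .
qed

text \<open>Folding \<open>f * indicator G\<close> over \<open>F\<close> leaves \<open>f x\<close>
  times the number of translates of \<open>x\<close> in \<open>G\<close>, which is almost everywhere
  one.\<close>

lemma nn_integral_fundamental_domain_cong:
  fixes f :: "real^'n \<Rightarrow> ennreal"
  assumes F: "fundamental_domain F" and G: "fundamental_domain G"
    and [measurable]: "f \<in> borel_measurable borel"
    and periodic: "\<And>x l. l \<in> L \<Longrightarrow> f (x + l) = f x"
  shows "(\<integral>\<^sup>+x. f x * indicator F x \<partial>lborel) = (\<integral>\<^sup>+x. f x * indicator G x \<partial>lborel)"
proof -
  have [measurable]: "F \<in> sets borel" "G \<in> sets borel"
    using F G by (auto simp: fundamental_domain_def)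
  have "(\<integral>\<^sup>+x. f x * indicator G x \<partial>lborel)
    = (\<integral>\<^sup>+x. indicator F x * (\<integral>\<^sup>+l. f (x + l) * indicator G (x + l) \<partial>count_space L) \<partial>lborel)"
    by (rule nn_integral_fold[OF F]) measurable
  also have "\<dots> = (\<integral>\<^sup>+x. f x * indicator F x \<partial>lborel)"
  proof (rule nn_integral_cong_AE)
    have "AE x in lborel. \<exists>!l. l \<in> L \<and> x + l \<in> G"
      using G by (simp add: fundamental_domain_def)
    then show "AE x in lborel. indicator F x * (\<integral>\<^sup>+l. f (x + l) * indicator G (x + l) \<partial>count_space L)
        = f x * indicator F x"
    proof eventually_elim
      fix x assume "\<exists>!l. l \<in> L \<and> x + l \<in> G"
      then obtain l where l: "l \<in> L" "x + l \<in> G" and u: "\<And>m. m \<in> L \<Longrightarrow> x + m \<in> G \<Longrightarrow> m = l"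
        by blast
      have "(\<integral>\<^sup>+m. f (x + m) * indicator G (x + m) \<partial>count_space L)
          = (\<integral>\<^sup>+m. f x * indicator {l} m \<partial>count_space L)"
        using l(2) by (intro nn_integral_cong) (auto simp: periodic split: split_indicator dest: u)
      also have "\<dots> = f x" using l by (simp add: nn_integral_cmult_indicator)
      finally show "indicator F x * (\<integral>\<^sup>+l. f (x + l) * indicator G (x + l) \<partial>count_space L)
        = f x * indicator F x" by (simp add: mult.commute)
    qed
  qed
  finally show ?thesis by simp
qed

text \<open>If the cell were null, folding the constant 1 would give the whole space measure
  0.\<close>

lemma measure_voronoi_pos: "measure lborel \<Omega> > 0"
proof -
  have "emeasure lborel \<Omega> \<noteq> 0"
  proof
    assume "emeasure lborel \<Omega> = 0"
    then have 0: "AE x in lborel. x \<notin> \<Omega>"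
      by (intro AE_not_in) (auto simp: null_sets_def)
    have "(\<integral>\<^sup>+x. 1 \<partial>(lborel :: (real^'n) measure))
      = (\<integral>\<^sup>+x. indicator \<Omega> x * (\<integral>\<^sup>+l. 1 \<partial>count_space L) \<partial>lborel)"
      by (rule nn_integral_fold[OF fundamental_domain_voronoi]) simp
    also have "\<dots> = (\<integral>\<^sup>+x. 0 \<partial>(lborel :: (real^'n) measure))"
      using 0 by (intro nn_integral_cong_AE) (auto elim!: eventually_mono)
    finally show False by simp
  qed
  then show ?thesis
    using finite_measure_voronoi by (simp add: measure_def enn2real_positive_iff zero_less_iff_neq_zero)
qed

text \<open>Translating the domain by \<open>s\<close> with \<open>k \<bullet> s = pi\<close> turns \<open>1 + cos\<close> into \<open>1 - cos\<close>; adding 1 keeps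
  the integrands nonnegative.\<close>

lemma integral_cos_voronoi:
  assumes k: "k \<noteq> 0" and dual: "\<And>l. l \<in> L \<Longrightarrow> \<exists>m::int. k \<bullet> l = 2 * pi * of_int m"
  shows "(\<integral>x. indicator \<Omega> x * cos (k \<bullet> x) \<partial>lborel) = 0"
proof -
  define s where "s = (pi / (k \<bullet> k)) *\<^sub>R k"
  have ks: "k \<bullet> s = pi" using k by (simp add: s_def)
  have per: "cos (k \<bullet> (x + l)) = cos (k \<bullet> x)" if l: "l \<in> L" for x l
  proof -
    from dual[OF l] obtain m where m: "k \<bullet> l = 2 * pi * of_int m" by blast
    show ?thesis
      unfolding inner_add_right m cos_add by (simp add: cos_int_2pin sin_int_2pin)
  qed
  have int: "integrable lborel (\<lambda>x. indicator \<Omega> x * (1 + e * cos (k \<bullet> x)))"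
    "integrable lborel (\<lambda>x. indicator \<Omega> x * cos (k \<bullet> x))" for e :: real
  proof -
    have *: "integrable lborel (\<lambda>x. indicator \<Omega> x :: real)"
      using finite_measure_voronoi by (intro integrable_real_indicator) auto
    show "integrable lborel (\<lambda>x. indicator \<Omega> x * cos (k \<bullet> x))"
      by (rule Bochner_Integration.integrable_bound[OF *]) (auto simp: indicator_def)
    then show "integrable lborel (\<lambda>x. indicator \<Omega> x * (1 + e * cos (k \<bullet> x)))"
      using * by (simp add: distrib_left mult.left_commute)
  qed
  have pos: "0 \<le> 1 + cos y" "0 \<le> 1 - cos y" for y :: real
    using cos_ge_minus_one[of y] cos_le_one[of y] by linarith+
  have "(\<integral>\<^sup>+x. ennreal (1 + cos (k \<bullet> x)) * indicator \<Omega> x \<partial>lborel)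
      = (\<integral>\<^sup>+x. ennreal (1 + cos (k \<bullet> x)) * indicator {x. x + (- s) \<in> \<Omega>} x \<partial>lborel)"
    by (intro nn_integral_fundamental_domain_cong fundamental_domain_voronoi
      fundamental_domain_translate) (auto simp: per)
  also have "\<dots> = (\<integral>\<^sup>+x. ennreal (1 + cos (k \<bullet> (x + s))) * indicator {x. x + (- s) \<in> \<Omega>} (x + s) \<partial>lborel)"
    using fundamental_domain_translate[OF fundamental_domain_voronoi, of "- s"]
    by (intro nn_integral_shift[symmetric] borel_measurable_times_ennreal borel_measurable_indicator)
       (auto simp: fundamental_domain_def)
  also have "\<dots> = (\<integral>\<^sup>+x. ennreal (1 - cos (k \<bullet> x)) * indicator \<Omega> x \<partial>lborel)"
    by (intro nn_integral_cong) (auto simp: indicator_def inner_add_right ks)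
  finally have "(\<integral>\<^sup>+x. ennreal (indicator \<Omega> x * (1 + 1 * cos (k \<bullet> x))) \<partial>lborel)
    = (\<integral>\<^sup>+x. ennreal (indicator \<Omega> x * (1 + (-1) * cos (k \<bullet> x))) \<partial>lborel)"
    by (simp add: ennreal_mult'' ennreal_indicator mult.commute pos flip: ennreal_mult')
  then have "(\<integral>x. indicator \<Omega> x * (1 + 1 * cos (k \<bullet> x)) \<partial>lborel)
    = (\<integral>x. indicator \<Omega> x * (1 + (-1) * cos (k \<bullet> x)) \<partial>lborel)"
    by (subst (1 2) integral_eq_nn_integral) (auto simp: pos)
  moreover have "(\<integral>x. 2 * (indicator \<Omega> x * cos (k \<bullet> x)) \<partial>lborel)
    = (\<integral>x. indicator \<Omega> x * (1 + 1 * cos (k \<bullet> x)) - indicator \<Omega> x * (1 + (-1) * cos (k \<bullet> x)) \<partial>lborel)"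
    by (intro Bochner_Integration.integral_cong) (auto simp: indicator_def)
  moreover have "\<dots> = (\<integral>x. indicator \<Omega> x * (1 + 1 * cos (k \<bullet> x)) \<partial>lborel)
      - (\<integral>x. indicator \<Omega> x * (1 + (-1) * cos (k \<bullet> x)) \<partial>lborel)"
    by (intro Bochner_Integration.integral_diff int)
  ultimately have "(\<integral>x. 2 * (indicator \<Omega> x * cos (k \<bullet> x)) \<partial>lborel) = 0"
    by linarith
  then show ?thesis by simp
qed

end

section \<open>Density of trigonometric polynomials\<close>

definition trig_polys :: "(real^'n) set \<Rightarrow> (real^'n \<Rightarrow> complex) set" where
  "trig_polys D = {\<lambda>x. \<Sum>b\<in>F. c b * cis (x \<bullet> b) | F c. finite F \<and> F \<subseteq> D}"

lemma trig_polysI: "finite F \<Longrightarrow> F \<subseteq> D \<Longrightarrow> (\<lambda>x. \<Sum>b\<in>F. c b * cis (x \<bullet> b)) \<in> trig_polys D"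
  unfolding trig_polys_def by blast

lemma trig_polysE:
  assumes "p \<in> trig_polys D"
  obtains F c where "finite F" "F \<subseteq> D" "p = (\<lambda>x. \<Sum>b\<in>F. c b * cis (x \<bullet> b))"
  using assms unfolding trig_polys_def by blast

lemma trig_polys_monomial: "b \<in> D \<Longrightarrow> (\<lambda>x. a * cis (x \<bullet> b)) \<in> trig_polys D"
  using trig_polysI[of "{b}" D "\<lambda>_. a"] by simp

lemma trig_polys_zero: "(\<lambda>x. 0) \<in> trig_polys D"
  using trig_polysI[of "{}" D] by simp

lemma trig_polys_add:
  assumes "p \<in> trig_polys D" "q \<in> trig_polys D"
  shows "(\<lambda>x. p x + q x) \<in> trig_polys D"
proof -
  obtain F c where p: "finite F" "F \<subseteq> D" "p = (\<lambda>x. \<Sum>b\<in>F. c b * cis (x \<bullet> b))"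
    using assms(1) by (rule trig_polysE)
  obtain G d where q: "finite G" "G \<subseteq> D" "q = (\<lambda>x. \<Sum>b\<in>G. d b * cis (x \<bullet> b))"
    using assms(2) by (rule trig_polysE)
  let ?c = "\<lambda>b. if b \<in> F then c b else 0" and ?d = "\<lambda>b. if b \<in> G then d b else 0"
  have 1: "(\<Sum>b\<in>F. c b * cis (x \<bullet> b)) = (\<Sum>b\<in>F \<union> G. ?c b * cis (x \<bullet> b))" for x
    using p q by (intro sum.mono_neutral_cong_left) auto
  have 2: "(\<Sum>b\<in>G. d b * cis (x \<bullet> b)) = (\<Sum>b\<in>F \<union> G. ?d b * cis (x \<bullet> b))" for x
    using p q by (intro sum.mono_neutral_cong_left) auto
  have "(\<lambda>x. p x + q x) = (\<lambda>x. \<Sum>b\<in>F \<union> G. (?c b + ?d b) * cis (x \<bullet> b))"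
    by (simp only: p(3) q(3) 1 2 distrib_right sum.distrib)
  then show ?thesis
    using p q trig_polysI[of "F \<union> G" D] by simp
qed

lemma trig_polys_sum:
  assumes "\<And>i. i \<in> I \<Longrightarrow> p i \<in> trig_polys D"
  shows "(\<lambda>x. \<Sum>i\<in>I. p i x) \<in> trig_polys D"
  using assms
  by (induction I rule: infinite_finite_induct) (auto intro: trig_polys_zero trig_polys_add)

lemma trig_polys_mult:
  assumes "\<And>a b. a \<in> D \<Longrightarrow> b \<in> D \<Longrightarrow> a + b \<in> D" "p \<in> trig_polys D" "q \<in> trig_polys D"
  shows "(\<lambda>x. p x * q x) \<in> trig_polys D"
proof -
  obtain F c where p: "finite F" "F \<subseteq> D" "p = (\<lambda>x. \<Sum>b\<in>F. c b * cis (x \<bullet> b))"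
    using assms(2) by (rule trig_polysE)
  obtain G d where q: "finite G" "G \<subseteq> D" "q = (\<lambda>x. \<Sum>b\<in>G. d b * cis (x \<bullet> b))"
    using assms(3) by (rule trig_polysE)
  have "(\<lambda>x. p x * q x) = (\<lambda>x. \<Sum>a\<in>F. \<Sum>b\<in>G. (c a * d b) * cis (x \<bullet> (a + b)))"
    unfolding p q sum_product by (simp add: inner_add_right cis_mult[symmetric] mult_ac)
  also have "\<dots> \<in> trig_polys D"
    using p q assms(1) by (intro trig_polys_sum trig_polys_monomial) blast
  finally show ?thesis .
qed

lemma borel_measurable_cis [measurable]: "cis \<in> borel_measurable borel"
  by (intro borel_measurable_continuous_onI continuous_intros)

lemma borel_measurable_trig_polys: "p \<in> trig_polys D \<Longrightarrow> p \<in> borel_measurable borel"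
  by (auto elim!: trig_polysE)

lemma cmod_sum_square_le: "(cmod (a + b))\<^sup>2 \<le> 2 * (cmod a)\<^sup>2 + 2 * (cmod b)\<^sup>2"
proof -
  have "(cmod (a + b))\<^sup>2 \<le> (cmod a + cmod b)\<^sup>2"
    by (intro power_mono norm_triangle_ineq) auto
  also have "\<dots> \<le> 2 * (cmod a)\<^sup>2 + 2 * (cmod b)\<^sup>2"
    using sum_squares_bound[of "cmod a" "cmod b"] by (simp add: power2_sum)
  finally show ?thesis .
qed

text \<open>In the application \<open>L\<close> is the spectral lattice \<open>\<Lambda>(A)\<close>, \<open>D\<close> the sampling lattice \<open>\<Lambda>(B)\<close>, and
  \<open>r i\<close> are the rows of \<open>B\<close>.\<close>

locale lattice_with_dual_basis = full_lattice L for L :: "(real^'n) set" +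
  fixes D :: "(real^'n) set" and r :: "'n \<Rightarrow> real^'n"
  assumes D_zero: "0 \<in> D" and D_uminus: "a \<in> D \<Longrightarrow> - a \<in> D"
    and D_add: "a \<in> D \<Longrightarrow> b \<in> D \<Longrightarrow> a + b \<in> D"
    and r_mem: "r i \<in> D"
    and pairing: "l \<in> L \<Longrightarrow> b \<in> D \<Longrightarrow> \<exists>m::int. l \<bullet> b = 2 * pi * of_int m"
    and mem_latticeI: "(\<And>i. \<exists>m::int. x \<bullet> r i = 2 * pi * of_int m) \<Longrightarrow> x \<in> L"
begin

text \<open>Realises the quotient by \<open>L\<close> inside a product of unit circles: the fibres
  are the cosets of \<open>L\<close>. Complex coordinates make trigonometric polynomials accessible
  to Stone-Weierstrass.\<close>

definition torus_map :: "real^'n \<Rightarrow> complex^'n" where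
  "torus_map x = (\<chi> i. cis (x \<bullet> r i))"

lemma torus_map_eqD:
  assumes "torus_map x = torus_map y"
  shows "x - y \<in> L"
proof (rule mem_latticeI)
  fix i
  have "exp (\<i> * of_real (x \<bullet> r i)) = exp (\<i> * of_real (y \<bullet> r i))"
    using assms by (simp add: torus_map_def vec_eq_iff cis_conv_exp)
  then obtain m :: int where
    "\<i> * of_real (x \<bullet> r i) = \<i> * of_real (y \<bullet> r i) + (of_int (2 * m) * pi) * \<i>"
    by (auto simp: exp_eq)
  then have "x \<bullet> r i = y \<bullet> r i + 2 * m * pi"
    by (auto simp: complex_eq_iff)
  then show "\<exists>m::int. (x - y) \<bullet> r i = 2 * pi * of_int m"
    by (intro exI[of _ m]) (simp add: inner_diff_left)
qed

lemma continuous_torus_map: "continuous_on S torus_map"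
  unfolding torus_map_def by (intro continuous_intros)

lemma trig_polys_const: "(\<lambda>x. a) \<in> trig_polys D"
  using trig_polys_monomial[OF D_zero, of a] by simp

text \<open>Real polynomials on \<open>complex^'n\<close> are generated by real and imaginary parts
  of coordinates. On the torus these are the cosine and sine of \<open>x \<bullet> r i\<close>,
  hence combinations of the characters of \<open>r i\<close> and \<open>- r i\<close>; sums and
  products stay within since \<open>D\<close> is closed under addition.\<close>

lemma trig_polys_real_polynomial:
  assumes "real_polynomial_function p"
  shows "(\<lambda>x. of_real (p (torus_map x))) \<in> trig_polys D"
  using assms
proof induction
  case (linear f)
  have *: "(\<lambda>x. of_real (f b * (torus_map x \<bullet> b))) \<in> trig_polys D" if b: "b \<in> Basis" for b
  proof -
    have m: "(\<lambda>x. a * cis (x \<bullet> r i) + a' * cis (x \<bullet> - r i)) \<in> trig_polys D" for a a' i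
      by (intro trig_polys_add trig_polys_monomial D_uminus r_mem)
    obtain i u where u: "u \<in> Basis" "b = axis i u" using b by (auto simp: Basis_vec_def)
    consider "u = 1" | "u = \<i>" using u by (auto simp: Basis_complex_def)
    then show ?thesis
    proof cases
      case 1
      have "(\<lambda>x. of_real (f b * (torus_map x \<bullet> b))) = (\<lambda>x. of_real (f b) / 2 * cis (x \<bullet> r i) + of_real (f b) / 2 * cis (x \<bullet> - r i))"
        unfolding u 1 inner_axis by (auto simp: torus_map_def complex_eq_iff)
      then show ?thesis using m by (simp only:)
    next
      \<comment> \<open>Here the basis vector reads off an imaginary part, and Euler's formula for
        the sine supplies the coefficients.\<close>
      case 2
      have "(\<lambda>x. of_real (f b * (torus_map x \<bullet> b))) = (\<lambda>x. (- \<i> * of_real (f b) / 2) * cis (x \<bullet> r i) + (\<i> * of_real (f b) / 2) * cis (x \<bullet> - r i))"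
        unfolding u 2 inner_axis by (auto simp: torus_map_def complex_eq_iff)
      then show ?thesis using m by (simp only:)
    qed
  qed
  have "f w = (\<Sum>b\<in>Basis. f b * (w \<bullet> b))" for w
  proof -
    interpret bounded_linear f by fact
    show ?thesis
      by (subst euclidean_representation[of w, symmetric]) (simp add: sum scaleR mult.commute del: euclidean_representation)
  qed
  then have "(\<lambda>x. of_real (f (torus_map x))) = (\<lambda>x. \<Sum>b\<in>Basis. of_real (f b * (torus_map x \<bullet> b)) :: complex)"
    by (metis (no_types, lifting) of_real_sum sum.cong)
  then show ?case using * by (auto intro: trig_polys_sum)
qed (auto intro!: trig_polys_const trig_polys_add trig_polys_mult D_add)

lemma trig_polys_polynomial:
  assumes "polynomial_function p"
  shows "(\<lambda>x. p (torus_map x)) \<in> trig_polys D"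
proof -
  have "real_polynomial_function (Re \<circ> p)" "real_polynomial_function (Im \<circ> p)"
    using assms bounded_linear_Re bounded_linear_Im unfolding polynomial_function_def by blast+
  then have "(\<lambda>x. of_real (Re (p (torus_map x)))) \<in> trig_polys D"
    "(\<lambda>x. of_real (Im (p (torus_map x)))) \<in> trig_polys D"
    by (auto dest: trig_polys_real_polynomial)
  then have "(\<lambda>x. of_real (Re (p (torus_map x))) + \<i> * of_real (Im (p (torus_map x)))) \<in> trig_polys D"
    by (intro trig_polys_add trig_polys_mult D_add trig_polys_const)
  then show ?thesis by (simp add: complex_eq[symmetric])
qed

section \<open>Square-mean closure of the trigonometric polynomials on the Voronoi cell\<close>

definition dist2 :: "(real^'n \<Rightarrow> complex) \<Rightarrow> (real^'n \<Rightarrow> complex) \<Rightarrow> ennreal" where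
  "dist2 f g = (\<integral>\<^sup>+x. indicator \<Omega> x * ennreal ((cmod (f x - g x))\<^sup>2) \<partial>lborel)"

text \<open>The quarters come from \<open>cmod_sum_square_le\<close>, which doubles each of the two
  squared errors.\<close>

lemma nn_integral_square_sum_less:
  assumes [measurable]: "f \<in> borel_measurable borel" "g \<in> borel_measurable borel"
    and f: "(\<integral>\<^sup>+x. indicator \<Omega> x * ennreal ((cmod (f x))\<^sup>2) \<partial>lborel) < ennreal (e / 4)"
    and g: "(\<integral>\<^sup>+x. indicator \<Omega> x * ennreal ((cmod (g x))\<^sup>2) \<partial>lborel) < ennreal (e / 4)"
  shows "(\<integral>\<^sup>+x. indicator \<Omega> x * ennreal ((cmod (f x + g x))\<^sup>2) \<partial>lborel) < ennreal e"
proof -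
  let ?I = "\<lambda>f. \<integral>\<^sup>+x. indicator \<Omega> x * ennreal ((cmod (f x))\<^sup>2) \<partial>lborel"
  have "?I (\<lambda>x. f x + g x) \<le> (\<integral>\<^sup>+x. 2 * (indicator \<Omega> x * ennreal ((cmod (f x))\<^sup>2)) + 2 * (indicator \<Omega> x * ennreal ((cmod (g x))\<^sup>2)) \<partial>lborel)"
  proof (rule nn_integral_mono)
    fix x
    have "ennreal ((cmod (f x + g x))\<^sup>2) \<le> ennreal (2 * (cmod (f x))\<^sup>2 + 2 * (cmod (g x))\<^sup>2)"
      by (intro ennreal_leI cmod_sum_square_le)
    also have "\<dots> = 2 * ennreal ((cmod (f x))\<^sup>2) + 2 * ennreal ((cmod (g x))\<^sup>2)"
      by (simp add: ennreal_mult)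
    finally show "indicator \<Omega> x * ennreal ((cmod (f x + g x))\<^sup>2) \<le> 2 * (indicator \<Omega> x * ennreal ((cmod (f x))\<^sup>2)) + 2 * (indicator \<Omega> x * ennreal ((cmod (g x))\<^sup>2))"
      by (auto split: split_indicator)
  qed
  also have "\<dots> = 2 * ?I f + 2 * ?I g"
    by (simp add: nn_integral_add nn_integral_cmult)
  also have "\<dots> < ennreal e"
  proof -
    obtain a where a: "?I f = ennreal a" "0 \<le> a" using f by (cases "?I f") auto
    obtain b where b: "?I g = ennreal b" "0 \<le> b" using g by (cases "?I g") auto
    have "a < e / 4" "b < e / 4" using f g a b by (auto simp: ennreal_less_iff)
    then have "ennreal (2 * a + 2 * b) < ennreal e"
      using a b by (subst ennreal_less_iff) auto
    moreover have "2 * ?I f + 2 * ?I g = ennreal (2 * a + 2 * b)"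
      using a b by (simp add: ennreal_mult)
    ultimately show ?thesis by (simp only:)
  qed
  finally show ?thesis .
qed

text \<open>Membership in the closure of the trigonometric polynomials in square mean over the cell.
  As \<open>dist2\<close> sees only \<open>\<Omega>\<close>, the function is arbitrary outside it
  apart from being Borel.\<close>

definition approximable :: "(real^'n \<Rightarrow> complex) \<Rightarrow> bool" where
  "approximable f \<longleftrightarrow> f \<in> borel_measurable borel
     \<and> (\<forall>e>0. \<exists>p\<in>trig_polys D. dist2 f p < ennreal e)"

lemma approximable_closed:
  assumes [measurable]: "f \<in> borel_measurable borel"
    and app: "\<And>e. e > 0 \<Longrightarrow> \<exists>g. approximable g \<and> dist2 f g < ennreal e"
  shows "approximable f"
  unfolding approximable_def
proof (intro conjI allI impI assms(1))
  fix e :: real assume "e > 0"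
  then obtain g where g: "approximable g" "dist2 f g < ennreal (e / 4)"
    using app[of "e / 4"] by auto
  then obtain p where p: "p \<in> trig_polys D" "dist2 g p < ennreal (e / 4)"
    using \<open>e > 0\<close> unfolding approximable_def by (meson divide_pos_pos zero_less_numeral)
  have [measurable]: "g \<in> borel_measurable borel" "p \<in> borel_measurable borel"
    using g p borel_measurable_trig_polys by (auto simp: approximable_def)
  have "dist2 f p < ennreal e"
    using nn_integral_square_sum_less[of "\<lambda>x. f x - g x" "\<lambda>x. g x - p x" e] g p
    by (simp add: dist2_def)
  with p show "\<exists>p\<in>trig_polys D. dist2 f p < ennreal e" by blast
qed

lemma approximable_add:
  assumes "approximable f" "approximable g"
  shows "approximable (\<lambda>x. f x + g x)"
  unfolding approximable_def
proof (intro conjI allI impI)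
  have [measurable]: "f \<in> borel_measurable borel" "g \<in> borel_measurable borel"
    using assms by (auto simp: approximable_def)
  show "(\<lambda>x. f x + g x) \<in> borel_measurable borel" by measurable
  fix e :: real assume "e > 0"
  then have "e / 4 > 0" by simp
  then obtain p q where p: "p \<in> trig_polys D" "dist2 f p < ennreal (e / 4)"
    and q: "q \<in> trig_polys D" "dist2 g q < ennreal (e / 4)"
    using assms unfolding approximable_def by meson
  have [measurable]: "p \<in> borel_measurable borel" "q \<in> borel_measurable borel"
    using p q borel_measurable_trig_polys by auto
  have "dist2 (\<lambda>x. f x + g x) (\<lambda>x. p x + q x) < ennreal e"
    using nn_integral_square_sum_less[of "\<lambda>x. f x - p x" "\<lambda>x. g x - q x" e] p q
    by (simp add: dist2_def add_diff_add)
  with trig_polys_add[OF p(1) q(1)]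
  show "\<exists>p\<in>trig_polys D. dist2 (\<lambda>x. f x + g x) p < ennreal e" by blast
qed

lemma approximable_cmult:
  assumes "approximable f"
  shows "approximable (\<lambda>x. a * f x)"
  unfolding approximable_def
proof (intro conjI allI impI)
  have [measurable]: "f \<in> borel_measurable borel"
    using assms by (auto simp: approximable_def)
  show "(\<lambda>x. a * f x) \<in> borel_measurable borel" by measurable
  fix e :: real assume "e > 0"
  \<comment> \<open>The added 1 keeps the divisor positive when \<open>a = 0\<close>.\<close>
  let ?k = "(cmod a)\<^sup>2 + 1"
  have k: "?k > 0" by (simp add: add_nonneg_pos)
  with \<open>e > 0\<close> have "e / ?k > 0" by simp
  then obtain p where p: "p \<in> trig_polys D" "dist2 f p < ennreal (e / ?k)"
    using assms unfolding approximable_def by meson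
  have [measurable]: "p \<in> borel_measurable borel"
    using p borel_measurable_trig_polys by auto
  obtain d where d: "dist2 f p = ennreal d" "0 \<le> d" using p by (cases "dist2 f p") auto
  have "dist2 (\<lambda>x. a * f x) (\<lambda>x. a * p x) = ennreal ((cmod a)\<^sup>2) * dist2 f p"
    unfolding dist2_def
    by (subst nn_integral_cmult[symmetric], measurable)
       (auto intro!: nn_integral_cong split: split_indicator
         simp: right_diff_distrib[symmetric] norm_mult power_mult_distrib ennreal_mult)
  also have "\<dots> = ennreal ((cmod a)\<^sup>2 * d)" using d by (simp add: ennreal_mult)
  also have "\<dots> < ennreal e"
  proof (rule ennreal_lessI[OF \<open>e > 0\<close>])
    have "d < e / ?k" using p d by (auto simp: ennreal_less_iff)
    then have "d * ?k < e" using k by (simp add: pos_less_divide_eq)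
    then show "(cmod a)\<^sup>2 * d < e" using d by (simp add: algebra_simps)
  qed
  finally have "dist2 (\<lambda>x. a * f x) (\<lambda>x. a * p x) < ennreal e" .
  moreover have "(\<lambda>x. a * p x) \<in> trig_polys D"
    by (intro trig_polys_mult D_add trig_polys_const p)
  ultimately show "\<exists>p\<in>trig_polys D. dist2 (\<lambda>x. a * f x) p < ennreal e" by blast
qed

lemma approximable_trig_poly: "p \<in> trig_polys D \<Longrightarrow> approximable p"
  unfolding approximable_def
  by (auto simp: borel_measurable_trig_polys dist2_def intro!: bexI[of _ p])

lemma approximable_sum:
  assumes "\<And>i. i \<in> I \<Longrightarrow> approximable (f i)"
  shows "approximable (\<lambda>x. \<Sum>i\<in>I. f i x)"
  using assms
  by (induction I rule: infinite_finite_induct)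
     (auto intro: approximable_trig_poly trig_polys_zero approximable_add)

text \<open>Dominated convergence on a cell of finite measure: the limit inherits the bound
  \<open>C\<close> there, so the constant \<open>(2 * C)\<close> squared is a majorant.\<close>

lemma approximable_bounded_limit:
  fixes f :: "nat \<Rightarrow> real^'n \<Rightarrow> complex"
  assumes app: "\<And>n. approximable (f n)" and [measurable]: "g \<in> borel_measurable borel"
    and bound: "\<And>n x. cmod (f n x) \<le> C"
    and lim: "AE x in lborel. x \<in> \<Omega> \<longrightarrow> (\<lambda>n. f n x) \<longlonglongrightarrow> g x"
  shows "approximable g"
proof (rule approximable_closed)
  have [measurable]: "f n \<in> borel_measurable borel" for n
    using app by (auto simp: approximable_def)
  have "(\<lambda>n. dist2 g (f n)) \<longlonglongrightarrow> (\<integral>\<^sup>+x. 0 \<partial>(lborel :: (real^'n) measure))"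
    unfolding dist2_def
  proof (rule nn_integral_dominated_convergence[where w="\<lambda>x. indicator \<Omega> x * ennreal ((2 * C)\<^sup>2)"])
    fix n
    show "AE x in lborel. indicator \<Omega> x * ennreal ((cmod (g x - f n x))\<^sup>2)
        \<le> indicator \<Omega> x * ennreal ((2 * C)\<^sup>2)"
      using lim
    proof eventually_elim
      fix x assume *: "x \<in> \<Omega> \<longrightarrow> (\<lambda>n. f n x) \<longlonglongrightarrow> g x"
      show "indicator \<Omega> x * ennreal ((cmod (g x - f n x))\<^sup>2) \<le> indicator \<Omega> x * ennreal ((2 * C)\<^sup>2)"
      proof (cases "x \<in> \<Omega>")
        case True
        then have "cmod (g x) \<le> C"
          using * bound by (intro Lim_bounded[OF tendsto_norm]) auto
        then have "cmod (g x - f n x) \<le> 2 * C"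
          using norm_triangle_ineq4[of "g x" "f n x"] bound[of n x] by linarith
        then show ?thesis by (intro mult_left_mono ennreal_leI power_mono) auto
      qed simp
    qed
  next
    show "(\<integral>\<^sup>+x. indicator \<Omega> x * ennreal ((2 * C)\<^sup>2) \<partial>lborel) < \<infinity>"
      using finite_measure_voronoi
      by (subst nn_integral_multc) (auto simp: ennreal_mult_less_top)
  next
    show "AE x in lborel. (\<lambda>n. indicator \<Omega> x * ennreal ((cmod (g x - f n x))\<^sup>2)) \<longlonglongrightarrow> 0"
      using lim
    proof eventually_elim
      fix x assume *: "x \<in> \<Omega> \<longrightarrow> (\<lambda>n. f n x) \<longlonglongrightarrow> g x"
      show "(\<lambda>n. indicator \<Omega> x * ennreal ((cmod (g x - f n x))\<^sup>2)) \<longlonglongrightarrow> 0"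
      proof (cases "x \<in> \<Omega>")
        case True
        then have "(\<lambda>n. (cmod (g x - f n x))\<^sup>2) \<longlonglongrightarrow> (cmod (g x - g x))\<^sup>2"
          using * by (intro tendsto_intros) auto
        then have "(\<lambda>n. ennreal ((cmod (g x - f n x))\<^sup>2)) \<longlonglongrightarrow> ennreal 0"
          by (intro tendsto_ennrealI) auto
        with True show ?thesis by simp
      qed simp
    qed
  qed measurable
  then have lim0: "(\<lambda>n. dist2 g (f n)) \<longlonglongrightarrow> 0" by simp
  fix e :: real assume "e > 0"
  with order_tendstoD(2)[OF lim0, of "ennreal e"] obtain n where "dist2 g (f n) < ennreal e"
    by (auto simp: eventually_sequentially)
  with app show "\<exists>h. approximable h \<and> dist2 g h < ennreal e" by blast
qed fact

text \<open>Stone-Weierstrass on the compact product of circles gives a polynomial uniformly close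
  to \<open>h\<close>; on a cell of finite volume uniform closeness implies closeness in square
  mean.\<close>

lemma approximable_comp_torus_map:
  assumes h: "continuous_on UNIV h"
  shows "approximable (\<lambda>x. h (torus_map x))"
proof (rule approximable_closed)
  have tm: "torus_map \<in> borel_measurable borel"
    by (intro borel_measurable_continuous_onI continuous_torus_map)
  have hm: "h \<in> borel_measurable borel"
    by (rule borel_measurable_continuous_onI) fact
  show [measurable]: "(\<lambda>x. h (torus_map x)) \<in> borel_measurable borel"
    using tm hm by measurable
  fix e :: real assume "e > 0"
  let ?S = "{z :: complex^'n. \<forall>i. cmod (z $ i) = 1}"
  let ?v = "measure lborel \<Omega>"
  have v: "?v > 0" by (rule measure_voronoi_pos)
  have "closed ?S"
    by (intro closed_Collect_all closed_Collect_eq continuous_intros)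
  moreover have "bounded ?S"
  proof -
    have "norm z \<le> (\<Sum>i\<in>(UNIV::'n set). 1)" if "z \<in> ?S" for z
      using L2_set_le_sum[of UNIV "\<lambda>i. cmod (z $ i)"] that by (simp add: norm_vec_def)
    then show ?thesis by (auto simp: bounded_iff)
  qed
  ultimately have S: "compact ?S" by (simp add: compact_eq_bounded_closed)
  \<comment> \<open>Chosen so that volume times \<open>d\<close> squared is \<open>e / 2\<close>,
    strictly below \<open>e\<close>.\<close>
  define d where "d = sqrt (e / (2 * ?v))"
  have "d > 0" using \<open>e > 0\<close> v by (simp add: d_def)
  then obtain g where g: "polynomial_function g" "\<And>z. z \<in> ?S \<Longrightarrow> norm (h z - g z) < d"
    using Stone_Weierstrass_polynomial_function[OF S continuous_on_subset[OF h subset_UNIV], of d]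
    by blast
  have "dist2 (\<lambda>x. h (torus_map x)) (\<lambda>x. g (torus_map x)) \<le> (\<integral>\<^sup>+x. indicator \<Omega> x * ennreal (d\<^sup>2) \<partial>lborel)"
    unfolding dist2_def
  proof (intro nn_integral_mono mult_left_mono ennreal_leI power_mono)
    fix x
    have "torus_map x \<in> ?S" by (simp add: torus_map_def)
    then show "cmod (h (torus_map x) - g (torus_map x)) \<le> d"
      by (intro less_imp_le g(2))
  qed auto
  also have "\<dots> = emeasure lborel \<Omega> * ennreal (d\<^sup>2)"
    by (subst nn_integral_multc) auto
  also have "\<dots> = ennreal (?v * d\<^sup>2)"
    using finite_measure_voronoi
    by (simp add: emeasure_eq_ennreal_measure ennreal_mult less_top)
  also have "\<dots> < ennreal e"
    using v \<open>e > 0\<close> by (auto simp: d_def intro!: ennreal_lessI)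
  finally show "\<exists>f. approximable f \<and> dist2 (\<lambda>x. h (torus_map x)) f < ennreal e"
    using approximable_trig_poly[OF trig_polys_polynomial[OF g(1)]] by blast
qed

text \<open>The functions \<open>max 0 (1 - n * infdist z (torus_map ` K))\<close> decrease to the indicator of
  \<open>torus_map ` K\<close>, whose pullback agrees with that of \<open>K\<close> almost everywhere on \<open>\<Omega>\<close>, since
  \<open>torus_map\<close> is injective there up to a null set.\<close>

lemma approximable_indicator_compact:
  assumes K: "compact K" "K \<subseteq> \<Omega>"
  shows "approximable (indicator K)"
proof (cases "K = {}")
  case True
  then have "indicator K = (\<lambda>x. 0 :: complex)" by auto
  then show ?thesis using approximable_trig_poly[OF trig_polys_zero] by simp
next
  case False
  let ?T = "torus_map ` K"
  have T: "closed ?T" "?T \<noteq> {}"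
    using K False by (auto intro!: compact_imp_closed compact_continuous_image continuous_torus_map)
  define h where "h n z = complex_of_real (max 0 (1 - real n * infdist z ?T))" for n :: nat and z
  show ?thesis
  proof (rule approximable_bounded_limit)
    show "approximable (\<lambda>x. h n (torus_map x))" for n
      unfolding h_def by (intro approximable_comp_torus_map continuous_intros)
    show "cmod (h n (torus_map x)) \<le> 1" for n x
      by (simp add: h_def infdist_nonneg)
    have "AE x in lborel. \<exists>!l. l \<in> L \<and> x + l \<in> \<Omega>"
      using fundamental_domain_voronoi by (simp add: fundamental_domain_def)
    then show "AE x in lborel. x \<in> \<Omega> \<longrightarrow> (\<lambda>n. h n (torus_map x)) \<longlonglongrightarrow> indicator K x"
    proof (eventually_elim, intro impI)
      fix x assume u: "\<exists>!l. l \<in> L \<and> x + l \<in> \<Omega>" and x: "x \<in> \<Omega>"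
      show "(\<lambda>n. h n (torus_map x)) \<longlonglongrightarrow> indicator K x"
      proof (cases "torus_map x \<in> ?T")
        case True
        then obtain y where y: "y \<in> K" "torus_map y = torus_map x" by auto
        have "y - x \<in> L" by (rule torus_map_eqD) fact
        moreover have "x + (y - x) \<in> \<Omega>" using y K by auto
        ultimately have "y - x = 0" using u x zero_mem by (metis add.right_neutral)
        then have "x \<in> K" using y by simp
        then show ?thesis using True by (simp add: h_def)
      next
        case False
        define c where "c = infdist (torus_map x) ?T"
        have "c > 0" using False T infdist_pos_not_in_closed[of ?T] by (auto simp: c_def)
        then obtain N where N: "1 < real N * c"
          using reals_Archimedean3[of c] by blast
        have "h n (torus_map x) = 0" if "n \<ge> N" for n
        proof -
          have "real N * c \<le> real n * c" using that \<open>c > 0\<close> by simp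
          then show ?thesis using N by (simp add: h_def c_def)
        qed
        then have "(\<lambda>n. h n (torus_map x)) \<longlonglongrightarrow> 0"
          by (intro tendsto_eventually) (auto simp: eventually_sequentially)
        moreover have "x \<notin> K" using False by auto
        ultimately show ?thesis by simp
      qed
    qed
    show "indicator K \<in> borel_measurable borel"
      using K by (intro borel_measurable_indicator) (simp add: borel_compact)
  qed
qed

text \<open>Inner regularity: a closed subset of \<open>E \<inter> \<Omega>\<close>, compact as the
  cell is bounded, misses measure less than \<open>e\<close>, and for nested indicators the squared
  distance is the measure missed.\<close>

lemma approximable_indicator:
  assumes [measurable]: "E \<in> sets borel"
  shows "approximable (indicator E)"
proof (rule approximable_closed)
  fix e :: real assume "e > 0"
  have "E \<inter> \<Omega> \<in> sets lebesgue" by simp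
  then obtain T where T: "closed T" "T \<subseteq> E \<inter> \<Omega>" "emeasure lebesgue (E \<inter> \<Omega> - T) < ennreal e"
    using sets_lebesgue_inner_closed[OF _ \<open>e > 0\<close>] by metis
  have [measurable]: "T \<in> sets borel" using T by simp
  have "compact T"
    using T bounded_subset[OF bounded_voronoi, of T] by (auto simp: compact_eq_bounded_closed)
  then have "approximable (indicator T)"
    using T by (intro approximable_indicator_compact) auto
  moreover have "dist2 (indicator E) (indicator T) < ennreal e"
  proof -
    have "dist2 (indicator E) (indicator T) = (\<integral>\<^sup>+x. indicator (E \<inter> \<Omega> - T) x \<partial>lborel)"
      unfolding dist2_def using T by (intro nn_integral_cong) (auto split: split_indicator)
    also have "\<dots> = emeasure lebesgue (E \<inter> \<Omega> - T)" by simp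
    finally show ?thesis using T by simp
  qed
  ultimately show "\<exists>g. approximable g \<and> dist2 (indicator E) g < ennreal e" by blast
qed measurable

text \<open>Simple functions are finite combinations of indicators, and those tending to
  \<open>f\<close> can be kept below \<open>2 * cmod (f x)\<close>, hence uniformly bounded.\<close>

lemma approximable_bounded:
  assumes f: "f \<in> borel_measurable borel" and bound: "\<And>x. cmod (f x) \<le> C"
  shows "approximable f"
proof -
  obtain s where s: "\<And>i. simple_function borel (s i)" "\<And>x. (\<lambda>i. s i x) \<longlonglongrightarrow> f x"
    "\<And>i x. cmod (s i x) \<le> 2 * cmod (f x)"
    using borel_measurable_implies_sequence_metric[OF f, of 0] by auto
  have "approximable (s i)" for i
  proof -
    have fin: "finite (s i ` UNIV)" using s(1)[of i] by (simp add: simple_function_def)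
    have "s i x = (\<Sum>y\<in>s i ` UNIV. y * indicator (s i -` {y}) x)" for x
    proof -
      have "(\<Sum>y\<in>s i ` UNIV. y * indicator (s i -` {y}) x) = (\<Sum>y\<in>s i ` UNIV. if y = s i x then y else 0)"
        by (intro sum.cong) (auto split: split_indicator)
      also have "\<dots> = s i x" using fin by (simp add: sum.delta')
      finally show ?thesis by simp
    qed
    then have "s i = (\<lambda>x. \<Sum>y\<in>s i ` UNIV. y * indicator (s i -` {y}) x)" by blast
    moreover have "approximable (\<lambda>x. \<Sum>y\<in>s i ` UNIV. y * indicator (s i -` {y}) x)"
    proof (intro approximable_sum approximable_cmult approximable_indicator)
      fix y assume "y \<in> range (s i)"
      then show "s i -` {y} \<in> sets borel" using s(1)[of i] by (auto simp: simple_function_def)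
    qed
    ultimately show ?thesis by simp
  qed
  moreover have "cmod (s i x) \<le> 2 * C" for i x
    using s(3)[of i x] bound[of x] by linarith
  ultimately show ?thesis
    using f s(2) by (intro approximable_bounded_limit[of s f "2 * C"]) auto
qed

end

section \<open>Projections and the spectral isometry\<close>

lemma integrable_mult_cnj:
  assumes Y: "square_integrable M Y" and Z: "square_integrable M Z"
  shows "integrable M (\<lambda>w. Y w * cnj (Z w))"
proof (rule Bochner_Integration.integrable_bound)
  show "integrable M (\<lambda>w. (cmod (Y w))\<^sup>2 + (cmod (Z w))\<^sup>2)"
    using assms by (auto simp: square_integrable_def)
  have [measurable]: "Y \<in> borel_measurable M" "Z \<in> borel_measurable M"
    using assms by (auto simp: square_integrable_def)
  have "cnj \<in> borel_measurable borel"
    by (intro borel_measurable_continuous_onI continuous_intros)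
  then show "(\<lambda>w. Y w * cnj (Z w)) \<in> borel_measurable M"
    by measurable
  show "AE w in M. norm (Y w * cnj (Z w)) \<le> norm ((cmod (Y w))\<^sup>2 + (cmod (Z w))\<^sup>2)"
  proof (rule AE_I2)
    fix w
    have "2 * (cmod (Y w) * cmod (Z w)) \<le> (cmod (Y w))\<^sup>2 + (cmod (Z w))\<^sup>2"
      using sum_squares_bound[of "cmod (Y w)" "cmod (Z w)"] by simp
    moreover have "0 \<le> cmod (Y w) * cmod (Z w)" by simp
    ultimately have "cmod (Y w) * cmod (Z w) \<le> (cmod (Y w))\<^sup>2 + (cmod (Z w))\<^sup>2" by linarith
    then show "norm (Y w * cnj (Z w)) \<le> norm ((cmod (Y w))\<^sup>2 + (cmod (Z w))\<^sup>2)"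
      by (simp add: norm_mult)
  qed
qed

lemma square_integrable_cmult:
  "square_integrable M Z \<Longrightarrow> square_integrable M (\<lambda>w. c * Z w)"
  by (auto simp: square_integrable_def norm_mult power_mult_distrib)

lemma square_integrable_add:
  assumes "square_integrable M Y" "square_integrable M Z"
  shows "square_integrable M (\<lambda>w. Y w + Z w)"
  unfolding square_integrable_def
proof
  have [measurable]: "Y \<in> borel_measurable M" "Z \<in> borel_measurable M"
    using assms by (auto simp: square_integrable_def)
  show "(\<lambda>w. Y w + Z w) \<in> borel_measurable M" by measurable
  show "integrable M (\<lambda>w. (cmod (Y w + Z w))\<^sup>2)"
  proof (rule Bochner_Integration.integrable_bound)
    show "integrable M (\<lambda>w. 2 * (cmod (Y w))\<^sup>2 + 2 * (cmod (Z w))\<^sup>2)"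
      using assms by (auto simp: square_integrable_def)
    show "AE w in M. norm ((cmod (Y w + Z w))\<^sup>2) \<le> norm (2 * (cmod (Y w))\<^sup>2 + 2 * (cmod (Z w))\<^sup>2)"
      using cmod_sum_square_le by auto
  qed measurable
qed

lemma square_integrable_diff:
  assumes "square_integrable M Y" "square_integrable M Z"
  shows "square_integrable M (\<lambda>w. Y w - Z w)"
  using square_integrable_add[OF assms(1) square_integrable_cmult[OF assms(2), of "- 1"]] by simp

lemma square_integrable_sum:
  "(\<And>i. i \<in> I \<Longrightarrow> square_integrable M (f i)) \<Longrightarrow> square_integrable M (\<lambda>w. \<Sum>i\<in>I. f i w)"
proof (induction I rule: infinite_finite_induct)
  case (insert i I)
  then show ?case using square_integrable_add[of M "f i"] by simp
qed (simp_all add: square_integrable_def)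

lemma finite_combinations_subset_closed_linear_span:
  assumes "\<And>t. square_integrable M (X t)"
  shows "finite_combinations X T \<subseteq> closed_linear_span M X T"
proof
  fix Y assume Y: "Y \<in> finite_combinations X T"
  then have "square_integrable M Y"
    by (auto simp: finite_combinations_def intro!: square_integrable_sum square_integrable_cmult assms)
  moreover have "L2_dist M Y Y = 0" by (simp add: L2_dist_def)
  ultimately show "Y \<in> closed_linear_span M X T"
    using Y by (force simp: closed_linear_span_def)
qed

text \<open>The cross term vanishes since \<open>Z - P\<close> is orthogonal to \<open>P\<close> and
  to \<open>Y\<close>. As \<open>V\<close> is an arbitrary set here, \<open>P - Y\<close> need not
  belong to it, so the two orthogonality relations are subtracted under the integral.\<close>

lemma projection_pythagoras:
  assumes "is_orthogonal_projection M V Z P" "Y \<in> V"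
    and Z: "square_integrable M Z" and P: "square_integrable M P" and Y: "square_integrable M Y"
  shows "(\<integral>w. (cmod (Z w - Y w))\<^sup>2 \<partial>M) = (\<integral>w. (cmod (Z w - P w))\<^sup>2 \<partial>M) + (\<integral>w. (cmod (P w - Y w))\<^sup>2 \<partial>M)"
proof -
  have ZP: "square_integrable M (\<lambda>w. Z w - P w)" and PY: "square_integrable M (\<lambda>w. P w - Y w)"
    using assms by (auto intro: square_integrable_diff)
  have 0: "(\<integral>w. (Z w - P w) * cnj (P w) \<partial>M) = 0" "(\<integral>w. (Z w - P w) * cnj (Y w) \<partial>M) = 0"
    using assms(1,2) by (auto simp: is_orthogonal_projection_def L2_inner_def)
  have "(\<integral>w. (Z w - P w) * cnj (P w) - (Z w - P w) * cnj (Y w) \<partial>M) = 0"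
    using 0 by (subst Bochner_Integration.integral_diff[OF integrable_mult_cnj[OF ZP P] integrable_mult_cnj[OF ZP Y]]) simp
  then have "(\<integral>w. (Z w - P w) * cnj (P w - Y w) \<partial>M) = 0"
    by (simp add: right_diff_distrib)
  then have c: "(\<integral>w. Re ((Z w - P w) * cnj (P w - Y w)) \<partial>M) = 0"
    using integral_Re[OF integrable_mult_cnj[OF ZP PY]] by simp
  have int: "integrable M (\<lambda>w. Re ((Z w - P w) * cnj (P w - Y w)))"
    by (intro integrable_Re integrable_mult_cnj ZP PY)
  have "(cmod (Z w - Y w))\<^sup>2 = (cmod (Z w - P w))\<^sup>2 + (cmod (P w - Y w))\<^sup>2
      + 2 * Re ((Z w - P w) * cnj (P w - Y w))" for w
    by (simp add: cmod_power2) (simp add: power2_eq_square algebra_simps)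
  then have "(\<integral>w. (cmod (Z w - Y w))\<^sup>2 \<partial>M) = (\<integral>w. ((cmod (Z w - P w))\<^sup>2 + (cmod (P w - Y w))\<^sup>2)
      + 2 * Re ((Z w - P w) * cnj (P w - Y w)) \<partial>M)"
    by (simp only:)
  also have "\<dots> = (\<integral>w. (cmod (Z w - P w))\<^sup>2 \<partial>M) + (\<integral>w. (cmod (P w - Y w))\<^sup>2 \<partial>M)
      + (\<integral>w. 2 * Re ((Z w - P w) * cnj (P w - Y w)) \<partial>M)"
    using ZP[unfolded square_integrable_def, THEN conjunct2]
      PY[unfolded square_integrable_def, THEN conjunct2] int
    by (simp only: Bochner_Integration.integral_add Bochner_Integration.integrable_add integrable_mult_right)
  also have "(\<integral>w. 2 * Re ((Z w - P w) * cnj (P w - Y w)) \<partial>M) = 0"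
    using c by (subst integral_mult_right_zero) (simp only: mult_zero_right)
  finally show ?thesis by simp
qed

lemma projection_error_le:
  assumes X: "\<And>t. square_integrable M (X t)"
    and proj: "is_orthogonal_projection M (closed_linear_span M X T) (X t) P"
    and Y: "Y \<in> finite_combinations X T"
  shows "(\<integral>w. (cmod (X t w - P w))\<^sup>2 \<partial>M) \<le> (\<integral>w. (cmod (X t w - Y w))\<^sup>2 \<partial>M)"
proof -
  have V: "Y \<in> closed_linear_span M X T" "P \<in> closed_linear_span M X T"
    using Y finite_combinations_subset_closed_linear_span[of M X T, OF X] proj
    by (auto simp: is_orthogonal_projection_def)
  then show ?thesis
    using projection_pythagoras[OF proj V(1) X] by (auto simp: closed_linear_span_def)
qed

text \<open>\<open>P\<close> lies in the closure, so some \<open>Y\<close> is within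
  \<open>sqrt e\<close> of it; by Pythagoras the error grows only by the square of that
  distance.\<close>

lemma projection_error_approx:
  assumes X: "\<And>t. square_integrable M (X t)"
    and proj: "is_orthogonal_projection M (closed_linear_span M X T) (X t) P"
    and e: "e > 0"
  shows "\<exists>Y\<in>finite_combinations X T.
    (\<integral>w. (cmod (X t w - Y w))\<^sup>2 \<partial>M) < (\<integral>w. (cmod (X t w - P w))\<^sup>2 \<partial>M) + e"
proof -
  have P: "P \<in> closed_linear_span M X T"
    using proj by (auto simp: is_orthogonal_projection_def)
  then obtain Y where Y: "Y \<in> finite_combinations X T" "L2_dist M P Y < sqrt e"
    using real_sqrt_gt_zero[OF e] unfolding closed_linear_span_def by blast
  have V: "Y \<in> closed_linear_span M X T"
    using Y finite_combinations_subset_closed_linear_span[of M X T, OF X] by blast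
  have "(\<integral>w. (cmod (P w - Y w))\<^sup>2 \<partial>M) < e"
    using Y(2) by (simp add: L2_dist_def)
  then show ?thesis
    using projection_pythagoras[OF proj V X] P V Y(1) by (force simp: closed_linear_span_def)
qed

section \<open>The spectral isometry on finite combinations\<close>

lemma integrable_spectral_exp:
  fixes S :: "real^'n \<Rightarrow> real"
  assumes S: "integrable lborel S"
  shows "integrable lborel (\<lambda>x. of_real (S x) * cis (x \<bullet> s))"
proof (rule Bochner_Integration.integrable_bound[OF S])
  have [measurable]: "S \<in> borel_measurable borel" using S by auto
  show "(\<lambda>x. of_real (S x) * cis (x \<bullet> s)) \<in> borel_measurable lborel" by measurable
qed (simp add: norm_mult)

lemma cmod_sum_square_eq:
  "complex_of_real ((cmod (\<Sum>i\<in>I. a i))\<^sup>2) = (\<Sum>i\<in>I. \<Sum>j\<in>I. a i * cnj (a j))"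
  by (simp only: complex_norm_square cnj_sum sum_product)

text \<open>Both sides are Hermitian forms in the coefficients, and the spectral density says that
  their Gram matrices agree. Points are indexed by a family so that repetitions among the
  \<open>q i\<close> are allowed.\<close>

lemma spectral_isometry:
  fixes X :: "real^'n \<Rightarrow> 'a \<Rightarrow> complex"
  assumes X: "\<And>t. square_integrable M (X t)" and psd: "has_power_spectral_density M X S"
  shows "(\<integral>w. (cmod (\<Sum>i\<in>I. c i * X (q i) w))\<^sup>2 \<partial>M)
      = 1 / (2 * pi) ^ CARD('n) * (\<integral>x. S x * (cmod (\<Sum>i\<in>I. c i * cis (x \<bullet> q i)))\<^sup>2 \<partial>lborel)"
    and "integrable lborel (\<lambda>x. S x * (cmod (\<Sum>i\<in>I. c i * cis (x \<bullet> q i)))\<^sup>2)"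
proof -
  let ?K = "1 / (2 * pi) ^ CARD('n)"
  have S: "integrable lborel S" using psd by (simp add: has_power_spectral_density_def)
  let ?f = "\<lambda>x. S x * (cmod (\<Sum>i\<in>I. c i * cis (x \<bullet> q i)))\<^sup>2"
  let ?g = "\<lambda>i j x. c i * cnj (c j) * (of_real (S x) * cis (x \<bullet> (q i - q j)))"
  have f: "complex_of_real (?f x) = (\<Sum>i\<in>I. \<Sum>j\<in>I. ?g i j x)" for x
  proof -
    have "cis (x \<bullet> (q i - q j)) = cis (x \<bullet> q i) * cnj (cis (x \<bullet> q j))" for i j
      by (simp add: cis_cnj cis_mult inner_diff_right)
    then show ?thesis
      unfolding of_real_mult cmod_sum_square_eq sum_distrib_left
      by (intro sum.cong refl) (simp add: mult_ac)
  qed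
  have g: "integrable lborel (?g i j)" for i j
    by (intro integrable_mult_right integrable_spectral_exp S)
  then have "integrable lborel (\<lambda>x. complex_of_real (?f x))"
    unfolding f by (intro Bochner_Integration.integrable_sum)
  from integrable_Re[OF this] show int_f: "integrable lborel ?f"
    by (simp only: Re_complex_of_real)
  have inner: "L2_inner M (X u) (X v) = of_real ?K * (\<integral>x. of_real (S x) * cis (x \<bullet> (u - v)) \<partial>lborel)" for u v
    using psd[unfolded has_power_spectral_density_def, THEN conjunct2, THEN conjunct2, rule_format, of v "u - v"]
    by (simp add: cis_conv_exp)
  have XX: "integrable M (\<lambda>w. c i * X (q i) w * cnj (c j * X (q j) w))" for i j
    by (intro integrable_mult_cnj square_integrable_cmult X)
  have "complex_of_real (\<integral>w. (cmod (\<Sum>i\<in>I. c i * X (q i) w))\<^sup>2 \<partial>M)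
      = (\<integral>w. (\<Sum>i\<in>I. \<Sum>j\<in>I. c i * X (q i) w * cnj (c j * X (q j) w)) \<partial>M)"
    unfolding cmod_sum_square_eq[symmetric]
  proof (rule integral_of_real[symmetric])
    have "square_integrable M (\<lambda>w. \<Sum>i\<in>I. c i * X (q i) w)"
      by (intro square_integrable_sum square_integrable_cmult X)
    then show "integrable M (\<lambda>w. (cmod (\<Sum>i\<in>I. c i * X (q i) w))\<^sup>2)"
      by (simp add: square_integrable_def)
  qed
  also have "\<dots> = (\<Sum>i\<in>I. \<Sum>j\<in>I. \<integral>w. c i * X (q i) w * cnj (c j * X (q j) w) \<partial>M)"
    using XX by (simp only: Bochner_Integration.integral_sum Bochner_Integration.integrable_sum)
  also have "\<dots> = (\<Sum>i\<in>I. \<Sum>j\<in>I. c i * cnj (c j) * L2_inner M (X (q i)) (X (q j)))"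
    unfolding L2_inner_def integral_mult_right_zero[symmetric]
    by (intro sum.cong Bochner_Integration.integral_cong refl) simp
  also have "\<dots> = of_real ?K * (\<Sum>i\<in>I. \<Sum>j\<in>I. \<integral>x. ?g i j x \<partial>lborel)"
    unfolding inner sum_distrib_left integral_mult_right_zero
    by (intro sum.cong refl) (simp only: mult_ac)
  also have "(\<Sum>i\<in>I. \<Sum>j\<in>I. \<integral>x. ?g i j x \<partial>lborel) = (\<integral>x. complex_of_real (?f x) \<partial>lborel)"
    unfolding f using g by (simp only: Bochner_Integration.integral_sum Bochner_Integration.integrable_sum)
  also have "\<dots> = complex_of_real (\<integral>x. ?f x \<partial>lborel)"
    by (rule integral_of_real[OF int_f])
  finally show "(\<integral>w. (cmod (\<Sum>i\<in>I. c i * X (q i) w))\<^sup>2 \<partial>M) = ?K * (\<integral>x. ?f x \<partial>lborel)"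
    by (simp only: of_real_mult[symmetric] of_real_eq_iff)
qed

lemma spectral_error:
  fixes X :: "real^'n \<Rightarrow> 'a \<Rightarrow> complex"
  assumes X: "\<And>t. square_integrable M (X t)" and psd: "has_power_spectral_density M X S"
    and F: "finite F"
  shows "(\<integral>w. (cmod (X t w - (\<Sum>b\<in>F. c b * X b w)))\<^sup>2 \<partial>M)
      = 1 / (2 * pi) ^ CARD('n) * (\<integral>x. S x * (cmod (cis (x \<bullet> t) - (\<Sum>b\<in>F. c b * cis (x \<bullet> b))))\<^sup>2 \<partial>lborel)"
    and "integrable lborel (\<lambda>x. S x * (cmod (cis (x \<bullet> t) - (\<Sum>b\<in>F. c b * cis (x \<bullet> b))))\<^sup>2)"
proof -
  \<comment> \<open>\<open>None\<close> carries the point \<open>t\<close> with coefficient 1,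
    \<open>Some b\<close> a sample with coefficient \<open>- c b\<close>. The option type keeps
    \<open>t\<close> apart even if it is itself one of the sample points in
    \<open>F\<close>.\<close>
  let ?I = "insert None (Some ` F)" and ?c = "case_option 1 (\<lambda>b. - c b)" and ?q = "case_option t id"
  have *: "(\<Sum>i\<in>?I. ?c i * g (?q i)) = g t - (\<Sum>b\<in>F. c b * g b)" for g :: "real^'n \<Rightarrow> complex"
    using F by (subst sum.insert) (auto simp: sum.reindex sum_negf)
  have X_eq: "(\<Sum>i\<in>?I. ?c i * X (?q i) w) = X t w - (\<Sum>b\<in>F. c b * X b w)" for w
    by (rule *)
  have cis_eq: "(\<Sum>i\<in>?I. ?c i * cis (x \<bullet> ?q i)) = cis (x \<bullet> t) - (\<Sum>b\<in>F. c b * cis (x \<bullet> b))" for x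
    by (rule *)
  show "(\<integral>w. (cmod (X t w - (\<Sum>b\<in>F. c b * X b w)))\<^sup>2 \<partial>M)
      = 1 / (2 * pi) ^ CARD('n) * (\<integral>x. S x * (cmod (cis (x \<bullet> t) - (\<Sum>b\<in>F. c b * cis (x \<bullet> b))))\<^sup>2 \<partial>lborel)"
    using spectral_isometry(1)[OF X psd, where I = ?I and c = ?c and q = ?q] unfolding X_eq cis_eq .
  show "integrable lborel (\<lambda>x. S x * (cmod (cis (x \<bullet> t) - (\<Sum>b\<in>F. c b * cis (x \<bullet> b))))\<^sup>2)"
    using spectral_isometry(2)[OF X psd, where I = ?I and c = ?c and q = ?q] unfolding cis_eq .
qed

section \<open>Folding the spectrum\<close>

text \<open>The parallel axis identity: \<open>s / n\<close> is the weighted mean of the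
  \<open>u l\<close>, and since these have modulus 1 the variance term is \<open>n\<close> minus the
  squared modulus of \<open>s\<close> over \<open>n\<close>.\<close>

lemma weighted_least_squares:
  fixes a :: "'i \<Rightarrow> real" and u :: "'i \<Rightarrow> complex"
  assumes A: "finite A" and a: "\<And>l. l \<in> A \<Longrightarrow> a l \<ge> 0" and u: "\<And>l. l \<in> A \<Longrightarrow> cmod (u l) = 1"
  defines "n \<equiv> \<Sum>l\<in>A. a l" and "s \<equiv> \<Sum>l\<in>A. a l * u l"
  shows "(\<Sum>l\<in>A. a l * (cmod (u l - p))\<^sup>2) = n * (cmod (s / n - p))\<^sup>2 + (n - (cmod s)\<^sup>2 / n)"
proof (cases "n = 0")
  \<comment> \<open>All weights vanish, and division by zero yields 0, so both sides are 0.\<close>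
  case True
  then have "\<forall>l\<in>A. a l = 0"
    using A a by (simp add: n_def sum_nonneg_eq_0_iff)
  then show ?thesis by (simp add: n_def s_def)
next
  case False
  have "(\<Sum>l\<in>A. a l * (cmod (u l - p))\<^sup>2) = (\<Sum>l\<in>A. a l + a l * (cmod p)\<^sup>2 - 2 * Re (cnj p * (a l * u l)))"
  proof (rule sum.cong)
    fix l assume "l \<in> A"
    then have "(cmod (u l))\<^sup>2 = 1" using u by simp
    then have 1: "(Re (u l))\<^sup>2 + (Im (u l))\<^sup>2 = 1" by (simp only: cmod_power2)
    have "(cmod (u l - p))\<^sup>2 = ((Re (u l))\<^sup>2 + (Im (u l))\<^sup>2) + (cmod p)\<^sup>2 - 2 * Re (cnj p * u l)"
      by (simp add: cmod_power2) (simp add: power2_eq_square algebra_simps)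
    then show "a l * (cmod (u l - p))\<^sup>2 = a l + a l * (cmod p)\<^sup>2 - 2 * Re (cnj p * (a l * u l))"
      by (simp only: 1) (simp add: algebra_simps)
  qed simp
  also have "\<dots> = n + n * (cmod p)\<^sup>2 - 2 * Re (cnj p * s)"
    by (simp add: n_def s_def sum.distrib sum_subtractf sum_distrib_left sum_distrib_right
      del: Re_sum times_complex.sel complex_cnj_mult flip: Re_sum sum_distrib_left)
  also have "\<dots> = n * (cmod (s / n - p))\<^sup>2 + (n - (cmod s)\<^sup>2 / n)"
    using False by (simp add: cmod_power2) (simp add: power2_eq_square field_simps)
  finally show ?thesis .
qed

locale ball_spectrum = lattice_with_dual_basis L D r for L D :: "(real^'n) set" and r +
  fixes \<omega>0 :: real
begin

abbreviation "\<Delta> \<equiv> cball (0 :: real^'n) \<omega>0"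

definition voronoi_radius :: real where
  "voronoi_radius = (SOME R. \<Omega> \<subseteq> cball 0 R)"

text \<open>Contains every \<open>l \<in> L\<close> for which \<open>\<Omega> + l\<close> meets \<open>\<Delta>\<close>, so that aliasing sums are finite. They are
  only meaningful at points of \<open>\<Omega>\<close>. If \<open>alias_count x = 0\<close>, the quotients below are 0.\<close>

definition near_points :: "(real^'n) set" where
  "near_points = L \<inter> cball 0 (\<omega>0 + voronoi_radius)"

definition alias_count :: "real^'n \<Rightarrow> real" where
  "alias_count x = (\<Sum>l\<in>near_points. indicator \<Delta> (x + l))"

text \<open>The factor \<open>cis (x \<bullet> t)\<close>, common to all values over
  \<open>x\<close>, is left out: it does not affect the modulus and returns in
  \<open>alias_mean\<close>.\<close>

definition alias_sum :: "real^'n \<Rightarrow> real^'n \<Rightarrow> complex" where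
  "alias_sum t x = (\<Sum>l\<in>near_points. of_real (indicator \<Delta> (x + l)) * cis (l \<bullet> t))"

text \<open>This will turn out to be the infimum, over trigonometric polynomials, of the squared
  error in approximating \<open>cis (x \<bullet> t)\<close> on the ball.\<close>

definition residual :: "real^'n \<Rightarrow> ennreal" where
  "residual t = (\<integral>\<^sup>+x. indicator \<Omega> x * ennreal (alias_count x - (cmod (alias_sum t x))\<^sup>2 / alias_count x) \<partial>lborel)"

lemma voronoi_radius: "\<Omega> \<subseteq> cball 0 voronoi_radius"
  unfolding voronoi_radius_def
  by (rule someI_ex) (use bounded_voronoi in \<open>auto simp: bounded_iff subset_iff\<close>)

lemma finite_near_points: "finite near_points"
  by (simp add: near_points_def finite_Int_cball)

lemma near_points_subset: "near_points \<subseteq> L"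
  by (simp add: near_points_def)

lemma not_near_point:
  assumes "x \<in> \<Omega>" "l \<in> L" "l \<notin> near_points"
  shows "x + l \<notin> \<Delta>"
proof
  assume "x + l \<in> \<Delta>"
  then have "norm (x + l) \<le> \<omega>0" by simp
  moreover have "norm x \<le> voronoi_radius" using assms voronoi_radius by auto
  moreover have "norm l \<le> norm (x + l) + norm x" using norm_triangle_ineq4[of "x + l" x] by simp
  ultimately show False using assms by (simp add: near_points_def)
qed

lemma alias_count_nonneg: "0 \<le> alias_count x"
  by (simp add: alias_count_def sum_nonneg)

lemma alias_count_le: "alias_count x \<le> card near_points"
  unfolding alias_count_def
  using sum_bounded_above[of near_points "\<lambda>l. indicator \<Delta> (x + l) :: real" 1] by simp

lemma cmod_alias_sum_le: "cmod (alias_sum t x) \<le> alias_count x"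
  unfolding alias_sum_def alias_count_def
  by (rule order_trans[OF norm_sum]) (simp add: norm_mult)

lemma residual_integrand:
  "0 \<le> alias_count x - (cmod (alias_sum t x))\<^sup>2 / alias_count x"
  "alias_count x - (cmod (alias_sum t x))\<^sup>2 / alias_count x \<le> alias_count x"
proof -
  have "(cmod (alias_sum t x))\<^sup>2 \<le> alias_count x * alias_count x"
    unfolding power2_eq_square
    by (intro mult_mono cmod_alias_sum_le alias_count_nonneg) auto
  then show "0 \<le> alias_count x - (cmod (alias_sum t x))\<^sup>2 / alias_count x"
    using alias_count_nonneg[of x] by (cases "alias_count x = 0") (auto simp: pos_divide_le_eq)
qed (simp add: alias_count_nonneg)

text \<open>Joint measurability in \<open>t\<close> and \<open>x\<close> makes
  \<open>residual\<close> measurable and allows the time and frequency integrals to be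
  exchanged.\<close>

lemma borel_measurable_alias [measurable]:
  "alias_count \<in> borel_measurable borel"
  "alias_sum t \<in> borel_measurable borel"
  "(\<lambda>(t, x). alias_sum t x) \<in> borel_measurable (borel \<Otimes>\<^sub>M borel)"
proof -
  have [measurable]: "\<Delta> \<in> sets borel" by simp
  show "alias_count \<in> borel_measurable borel" unfolding alias_count_def by measurable
  show "alias_sum t \<in> borel_measurable borel" unfolding alias_sum_def by measurable
  show "(\<lambda>(t, x). alias_sum t x) \<in> borel_measurable (borel \<Otimes>\<^sub>M borel)"
    unfolding alias_sum_def by measurable
qed

text \<open>For \<open>x\<close> in the cell only near points can carry \<open>x\<close> into the
  ball, so the lattice sum in the folding formula becomes finite.\<close>

lemma nn_integral_fold_ball:
  fixes g :: "real^'n \<Rightarrow> real"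
  assumes [measurable]: "g \<in> borel_measurable borel" and g: "\<And>x. 0 \<le> g x"
  shows "(\<integral>\<^sup>+x. ennreal (indicator \<Delta> x * g x) \<partial>lborel)
    = (\<integral>\<^sup>+x. indicator \<Omega> x * ennreal (\<Sum>l\<in>near_points. indicator \<Delta> (x + l) * g (x + l)) \<partial>lborel)"
proof -
  have [measurable]: "\<Delta> \<in> sets borel" by simp
  have "(\<integral>\<^sup>+x. ennreal (indicator \<Delta> x * g x) \<partial>lborel)
    = (\<integral>\<^sup>+x. indicator \<Omega> x * (\<integral>\<^sup>+l. ennreal (indicator \<Delta> (x + l) * g (x + l)) \<partial>count_space L) \<partial>lborel)"
    by (rule nn_integral_fold[OF fundamental_domain_voronoi, of "\<lambda>x. ennreal (indicator \<Delta> x * g x)"])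
       measurable
  also have "\<dots> = (\<integral>\<^sup>+x. indicator \<Omega> x * ennreal (\<Sum>l\<in>near_points. indicator \<Delta> (x + l) * g (x + l)) \<partial>lborel)"
  proof (rule nn_integral_cong)
    fix x
    show "indicator \<Omega> x * (\<integral>\<^sup>+l. ennreal (indicator \<Delta> (x + l) * g (x + l)) \<partial>count_space L)
      = indicator \<Omega> x * ennreal (\<Sum>l\<in>near_points. indicator \<Delta> (x + l) * g (x + l))"
    proof (cases "x \<in> \<Omega>")
      case True
      have "(\<integral>\<^sup>+l. ennreal (indicator \<Delta> (x + l) * g (x + l)) \<partial>count_space L)
          = (\<Sum>l\<in>near_points. ennreal (indicator \<Delta> (x + l) * g (x + l)))"
        using finite_near_points near_points_subset not_near_point[OF True]
        by (intro nn_integral_count_space') (auto simp del: mem_cball)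
      also have "\<dots> = ennreal (\<Sum>l\<in>near_points. indicator \<Delta> (x + l) * g (x + l))"
        by (intro sum_ennreal) (simp add: g)
      finally show ?thesis by simp
    qed simp
  qed
  finally show ?thesis .
qed

lemma trig_polys_periodic:
  assumes "p \<in> trig_polys D" "l \<in> L"
  shows "p (x + l) = p x"
proof -
  obtain F c where p: "finite F" "F \<subseteq> D" "p = (\<lambda>x. \<Sum>b\<in>F. c b * cis (x \<bullet> b))"
    using assms(1) by (rule trig_polysE)
  have "cis ((x + l) \<bullet> b) = cis (x \<bullet> b)" if "b \<in> F" for b
  proof -
    obtain m :: int where m: "l \<bullet> b = 2 * pi * of_int m"
      using pairing[of l b] p assms \<open>b \<in> F\<close> by blast
    have "cis (l \<bullet> b) = 1" unfolding m by (rule cis_multiple_2pi) simp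
    then show ?thesis by (simp add: inner_add_left cis_mult[symmetric])
  qed
  then show ?thesis unfolding p by simp
qed

section \<open>Best periodic approximation over the aliases\<close>

definition alias_mean :: "real^'n \<Rightarrow> real^'n \<Rightarrow> complex" where
  "alias_mean t x = cis (x \<bullet> t) * alias_sum t x / alias_count x"

lemma borel_measurable_alias_mean [measurable]: "alias_mean t \<in> borel_measurable borel"
  unfolding alias_mean_def by measurable

lemma cmod_alias_mean_le: "cmod (alias_mean t x) \<le> 1"
  using cmod_alias_sum_le[of t x] alias_count_nonneg[of x]
  by (cases "alias_count x = 0") (auto simp: alias_mean_def norm_mult norm_divide)

text \<open>A periodic \<open>p\<close> takes a single value on all aliases of \<open>x\<close>, so
  the least squares identity applies pointwise with the indicators of the ball as weights. Only the
  first term on the right depends on \<open>p\<close>.\<close>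

lemma trig_poly_error:
  assumes p: "p \<in> trig_polys D"
  shows "(\<integral>\<^sup>+x. ennreal (indicator \<Delta> x * (cmod (cis (x \<bullet> t) - p x))\<^sup>2) \<partial>lborel)
    = (\<integral>\<^sup>+x. indicator \<Omega> x * ennreal (alias_count x * (cmod (alias_mean t x - p x))\<^sup>2) \<partial>lborel) + residual t"
proof -
  have [measurable]: "p \<in> borel_measurable borel" by (rule borel_measurable_trig_polys) fact
  have *: "(\<Sum>l\<in>near_points. indicator \<Delta> (x + l) * (cmod (cis ((x + l) \<bullet> t) - p (x + l)))\<^sup>2)
     = alias_count x * (cmod (alias_mean t x - p x))\<^sup>2
       + (alias_count x - (cmod (alias_sum t x))\<^sup>2 / alias_count x)" for x
  proof -
    have "(\<Sum>l\<in>near_points. complex_of_real (indicator \<Delta> (x + l)) * cis ((x + l) \<bullet> t)) = cis (x \<bullet> t) * alias_sum t x"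
      by (simp add: alias_sum_def sum_distrib_left inner_add_left cis_mult[symmetric] mult_ac)
    moreover have "(\<Sum>l\<in>near_points. indicator \<Delta> (x + l) * (cmod (cis ((x + l) \<bullet> t) - p (x + l)))\<^sup>2)
      = (\<Sum>l\<in>near_points. indicator \<Delta> (x + l) * (cmod (cis ((x + l) \<bullet> t) - p x))\<^sup>2)"
      using near_points_subset by (intro sum.cong refl) (auto simp: trig_polys_periodic[OF p])
    ultimately show ?thesis
      using weighted_least_squares[OF finite_near_points, of "\<lambda>l. indicator \<Delta> (x + l)" "\<lambda>l. cis ((x + l) \<bullet> t)" "p x"]
      by (simp add: alias_mean_def norm_mult flip: alias_count_def)
  qed
  have "(\<integral>\<^sup>+x. ennreal (indicator \<Delta> x * (cmod (cis (x \<bullet> t) - p x))\<^sup>2) \<partial>lborel)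
    = (\<integral>\<^sup>+x. indicator \<Omega> x * ennreal (\<Sum>l\<in>near_points. indicator \<Delta> (x + l) * (cmod (cis ((x + l) \<bullet> t) - p (x + l)))\<^sup>2) \<partial>lborel)"
    by (rule nn_integral_fold_ball) auto
  also have "\<dots> = (\<integral>\<^sup>+x. indicator \<Omega> x * ennreal (alias_count x * (cmod (alias_mean t x - p x))\<^sup>2)
      + indicator \<Omega> x * ennreal (alias_count x - (cmod (alias_sum t x))\<^sup>2 / alias_count x) \<partial>lborel)"
    unfolding * using alias_count_nonneg residual_integrand(1)
    by (intro nn_integral_cong) (simp add: ennreal_plus distrib_left)
  also have "\<dots> = (\<integral>\<^sup>+x. indicator \<Omega> x * ennreal (alias_count x * (cmod (alias_mean t x - p x))\<^sup>2) \<partial>lborel) + residual t"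
    unfolding residual_def by (rule nn_integral_add) measurable
  finally show ?thesis .
qed

lemma trig_poly_error_ge:
  assumes "p \<in> trig_polys D"
  shows "residual t \<le> (\<integral>\<^sup>+x. ennreal (indicator \<Delta> x * (cmod (cis (x \<bullet> t) - p x))\<^sup>2) \<partial>lborel)"
  unfolding trig_poly_error[OF assms] by simp

text \<open>The excess over \<open>residual t\<close> is a squared distance from \<open>p\<close> to
  \<open>alias_mean t\<close> weighted by \<open>alias_count\<close>. The weight is bounded, so
  unweighted density on the cell suffices.\<close>

lemma trig_poly_error_approx:
  assumes e: "e > 0"
  shows "\<exists>p\<in>trig_polys D. (\<integral>\<^sup>+x. ennreal (indicator \<Delta> x * (cmod (cis (x \<bullet> t) - p x))\<^sup>2) \<partial>lborel) \<le> residual t + ennreal e"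
proof -
  \<comment> \<open>A bound for \<open>alias_count\<close>, raised by 1 so that dividing by it is
    safe.\<close>
  let ?N = "real (card near_points) + 1"
  have "approximable (alias_mean t)"
    by (rule approximable_bounded[OF _ cmod_alias_mean_le]) measurable
  moreover have "e / ?N > 0" using e by (simp add: add_nonneg_pos)
  ultimately obtain p where p: "p \<in> trig_polys D" "dist2 (alias_mean t) p < ennreal (e / ?N)"
    unfolding approximable_def by blast
  have [measurable]: "p \<in> borel_measurable borel" by (rule borel_measurable_trig_polys) fact
  have "(\<integral>\<^sup>+x. indicator \<Omega> x * ennreal (alias_count x * (cmod (alias_mean t x - p x))\<^sup>2) \<partial>lborel)
     \<le> (\<integral>\<^sup>+x. ennreal ?N * (indicator \<Omega> x * ennreal ((cmod (alias_mean t x - p x))\<^sup>2)) \<partial>lborel)"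
  proof (rule nn_integral_mono)
    fix x
    have "alias_count x * (cmod (alias_mean t x - p x))\<^sup>2 \<le> ?N * (cmod (alias_mean t x - p x))\<^sup>2"
      using alias_count_le[of x] by (intro mult_right_mono) auto
    then have "ennreal (alias_count x * (cmod (alias_mean t x - p x))\<^sup>2) \<le> ennreal ?N * ennreal ((cmod (alias_mean t x - p x))\<^sup>2)"
      by (subst ennreal_mult[symmetric]) (auto intro: ennreal_leI)
    then show "indicator \<Omega> x * ennreal (alias_count x * (cmod (alias_mean t x - p x))\<^sup>2)
      \<le> ennreal ?N * (indicator \<Omega> x * ennreal ((cmod (alias_mean t x - p x))\<^sup>2))"
      by (auto split: split_indicator)
  qed
  also have "\<dots> = ennreal ?N * dist2 (alias_mean t) p"
    unfolding dist2_def by (rule nn_integral_cmult) measurable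
  also have "\<dots> \<le> ennreal ?N * ennreal (e / ?N)"
    using p by (intro mult_left_mono) auto
  also have "\<dots> = ennreal e"
    using e by (subst ennreal_mult[symmetric]) (auto simp: add_nonneg_pos)
  finally show ?thesis
    using p(1) by (intro bexI[of _ p]) (auto simp: trig_poly_error add.commute intro: add_left_mono)
qed

lemma nn_integral_alias_count:
  "(\<integral>\<^sup>+x. indicator \<Omega> x * ennreal (alias_count x) \<partial>lborel) = emeasure lborel \<Delta>"
  using nn_integral_fold_ball[of "\<lambda>_. 1"]
  by (simp add: alias_count_def[symmetric] ennreal_indicator)

lemma residual_le: "residual t \<le> emeasure lborel \<Delta>"
  unfolding residual_def nn_integral_alias_count[symmetric]
  using residual_integrand(2) by (intro nn_integral_mono mult_left_mono ennreal_leI) auto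

lemma residual_finite: "residual t < \<infinity>"
  using residual_le[of t] emeasure_bounded_finite[OF bounded_cball, of "0 :: real^'n" \<omega>0]
  by (simp add: order_le_less_trans)

lemma borel_measurable_residual [measurable]: "residual \<in> borel_measurable borel"
  unfolding residual_def by measurable

end

section \<open>Lattices generated by matrices\<close>

lemma finite_bounded_integer_vectors:
  "finite {v :: real^'n. (\<forall>i. \<exists>m::int. v $ i = of_int m) \<and> norm v \<le> C}"
proof (rule finite_subset)
  let ?K = "{- \<lceil>C\<rceil>..\<lceil>C\<rceil>}"
  show "finite ((\<lambda>f. (\<chi> i. real_of_int (f i)) :: real^'n) ` (UNIV \<rightarrow>\<^sub>E ?K))"
    by (intro finite_imageI finite_PiE) auto
  show "{v :: real^'n. (\<forall>i. \<exists>m::int. v $ i = of_int m) \<and> norm v \<le> C}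
    \<subseteq> (\<lambda>f. (\<chi> i. real_of_int (f i)) :: real^'n) ` (UNIV \<rightarrow>\<^sub>E ?K)"
  proof
    fix v :: "real^'n" assume v: "v \<in> {v. (\<forall>i. \<exists>m::int. v $ i = of_int m) \<and> norm v \<le> C}"
    then obtain f :: "'n \<Rightarrow> int" where f: "\<And>i. v $ i = of_int (f i)" by (auto simp: choice_iff)
    have "f i \<in> ?K" for i
    proof -
      have "\<bar>v $ i\<bar> \<le> C" using component_le_norm_cart[of v i] v by auto
      then have "\<bar>real_of_int (f i)\<bar> \<le> C" using f by simp
      then show ?thesis by (auto simp: abs_le_iff le_ceiling_iff ceiling_le_iff; linarith)
    qed
    moreover have "v = (\<chi> i. real_of_int (f i))" using f by (simp add: vec_eq_iff)
    ultimately show "v \<in> (\<lambda>f. (\<chi> i. real_of_int (f i)) :: real^'n) ` (UNIV \<rightarrow>\<^sub>E ?K)" by auto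
  qed
qed

text \<open>Common shape of both lattices: \<open>W\<close> will be the inverse transpose of
  \<open>B\<close> for the samples and \<open>B\<close> over \<open>2 * pi\<close> for the dual.
  Boundedness of \<open>W\<close> gives discreteness; rounding the coordinates of
  \<open>W *v x\<close> down and mapping back by the bounded inverse gives the covering
  radius.\<close>

lemma full_lattice_integer_preimage:
  fixes W :: "real^'n^'n"
  assumes W: "invertible W"
  shows "full_lattice {x. \<forall>i. \<exists>m::int. (W *v x) $ i = of_int m}" (is "full_lattice ?L")
proof
  obtain V where V: "V ** W = mat 1" "W ** V = mat 1" using W by (auto simp: invertible_def)
  have inv: "V *v (W *v x) = x" "W *v (V *v x) = x" for x
    using V by (simp_all add: matrix_vector_mul_assoc)
  have bl: "bounded_linear ((*v) A)" for A :: "real^'n^'n"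
    by (simp add: linear_linear)
  show "0 \<in> ?L" by (auto intro: exI[of _ 0])
  show "x - y \<in> ?L" if "x \<in> ?L" "y \<in> ?L" for x y
    using that unfolding mem_Collect_eq matrix_vector_mult_diff_distrib vector_minus_component
    by (metis of_int_diff)
  show "finite (?L \<inter> cball 0 r)" for r
  proof -
    have "?L \<inter> cball 0 r \<subseteq> (*v) V ` {v. (\<forall>i. \<exists>m::int. v $ i = of_int m) \<and> norm v \<le> onorm ((*v) W) * r}"
    proof
      fix x assume x: "x \<in> ?L \<inter> cball 0 r"
      have "norm (W *v x) \<le> onorm ((*v) W) * norm x" by (rule onorm[OF bl])
      also have "\<dots> \<le> onorm ((*v) W) * r" using x by (intro mult_left_mono onorm_pos_le[OF bl]) auto
      finally show "x \<in> (*v) V ` {v. (\<forall>i. \<exists>m::int. v $ i = of_int m) \<and> norm v \<le> onorm ((*v) W) * r}"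
        using x inv(1)[of x] by (intro image_eqI[of _ _ "W *v x"]) auto
    qed
    then show ?thesis
      using finite_bounded_integer_vectors by (rule finite_subset[OF _ finite_imageI])
  qed
  show "\<exists>R. \<forall>x. \<exists>l\<in>?L. norm (x - l) \<le> R"
  proof (intro exI allI)
    fix x
    let ?v = "(\<chi> i. of_int \<lfloor>(W *v x) $ i\<rfloor>) :: real^'n"
    have "norm (W *v x - ?v) \<le> (\<Sum>i\<in>(UNIV::'n set). 1)"
      using norm_le_l1_cart[of "W *v x - ?v"]
    proof (rule order_trans)
      show "(\<Sum>i\<in>UNIV. \<bar>(W *v x - ?v) $ i\<bar>) \<le> (\<Sum>i\<in>(UNIV::'n set). 1)"
        by (rule sum_mono) (simp, linarith)
    qed
    moreover have "x - V *v ?v = V *v (W *v x - ?v)"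
      by (simp only: matrix_vector_mult_diff_distrib inv)
    moreover have "norm (V *v (W *v x - ?v)) \<le> onorm ((*v) V) * norm (W *v x - ?v)"
      by (rule onorm[OF bl])
    ultimately have "norm (x - V *v ?v) \<le> onorm ((*v) V) * (\<Sum>i\<in>(UNIV::'n set). 1)"
      using mult_left_mono[OF _ onorm_pos_le[OF bl[of V]]] order_trans by (simp only:) blast
    moreover have "V *v ?v \<in> ?L" unfolding mem_Collect_eq inv by simp
    ultimately show "\<exists>l\<in>?L. norm (x - l) \<le> onorm ((*v) V) * (\<Sum>i\<in>(UNIV::'n set). 1)" by blast
  qed
qed

lemma lattice_of_eq: "lattice_of B = {transpose B *v v | v. \<forall>i. \<exists>m::int. v $ i = of_int m}"
proof -
  have *: "(\<Sum>i\<in>UNIV. of_int (k i) *\<^sub>R row i B) = transpose B *v (\<chi> i. of_int (k i))" for k :: "'a \<Rightarrow> int"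
    by (simp add: vec_eq_iff matrix_vector_mult_def row_def transpose_def mult.commute)
  show ?thesis
  proof (intro equalityI subsetI)
    fix x assume "x \<in> lattice_of B"
    then obtain k :: "'a \<Rightarrow> int" where "x = transpose B *v (\<chi> i. of_int (k i))"
      unfolding lattice_of_def * by blast
    then show "x \<in> {transpose B *v v | v. \<forall>i. \<exists>m::int. v $ i = of_int m}" by auto
  next
    fix x assume "x \<in> {transpose B *v v | v. \<forall>i. \<exists>m::int. v $ i = of_int m}"
    then obtain v where v: "x = transpose B *v v" "\<forall>i. \<exists>m::int. v $ i = of_int m" by blast
    then obtain k :: "'a \<Rightarrow> int" where "\<And>i. v $ i = of_int (k i)" by (auto simp: choice_iff)
    then have "v = (\<chi> i. of_int (k i))" by (simp add: vec_eq_iff)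
    then show "x \<in> lattice_of B" unfolding lattice_of_def * using v by blast
  qed
qed

lemma full_lattice_lattice_of:
  assumes B: "invertible B"
  shows "full_lattice (lattice_of B)"
proof -
  obtain C where C: "B ** C = mat 1" "C ** B = mat 1" using B by (auto simp: invertible_def)
  have T: "transpose B ** transpose C = mat 1" "transpose C ** transpose B = mat 1"
    using C by (simp_all add: transpose_mat flip: matrix_transpose_mul)
  have "lattice_of B = {x. \<forall>i. \<exists>m::int. (transpose C *v x) $ i = of_int m}"
    unfolding lattice_of_eq
  proof (intro equalityI subsetI)
    fix x assume "x \<in> {x. \<forall>i. \<exists>m::int. (transpose C *v x) $ i = of_int m}"
    moreover have "x = transpose B *v (transpose C *v x)" by (simp only: matrix_vector_mul_assoc T matrix_vector_mul_lid)
    ultimately show "x \<in> {transpose B *v v | v. \<forall>i. \<exists>m::int. v $ i = of_int m}" by blast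
  next
    fix x assume "x \<in> {transpose B *v v | v. \<forall>i. \<exists>m::int. v $ i = of_int m}"
    then obtain v where "x = transpose B *v v" "\<forall>i. \<exists>m::int. v $ i = of_int m" by blast
    moreover from this have "transpose C *v x = v"
      by (simp only: matrix_vector_mul_assoc T matrix_vector_mul_lid)
    ultimately show "x \<in> {x. \<forall>i. \<exists>m::int. (transpose C *v x) $ i = of_int m}" by simp
  qed
  moreover have "invertible (transpose C)" using T unfolding invertible_def by blast
  ultimately show ?thesis using full_lattice_integer_preimage[of "transpose C"] by (simp only:)
qed

lemma row_mem_lattice_of: "row i B \<in> lattice_of B"
  unfolding lattice_of_def
proof (intro CollectI exI conjI)
  show "row i B = (\<Sum>j\<in>UNIV. of_int ((\<lambda>j. if j = i then 1 else 0) j) *\<^sub>R row j B)"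
    by (simp add: if_distrib[of "\<lambda>k. k *\<^sub>R _"] if_distrib[of of_int] sum.delta cong: if_cong)
qed simp

lemma mem_scaled_dual_lattice_of_iff:
  "x \<in> scaled_dual (lattice_of B) \<longleftrightarrow> (\<forall>i. \<exists>m::int. x \<bullet> row i B = 2 * pi * of_int m)"
proof
  assume "x \<in> scaled_dual (lattice_of B)"
  then show "\<forall>i. \<exists>m::int. x \<bullet> row i B = 2 * pi * of_int m"
    using row_mem_lattice_of unfolding scaled_dual_def by blast
next
  assume "\<forall>i. \<exists>m::int. x \<bullet> row i B = 2 * pi * of_int m"
  then obtain m :: "_ \<Rightarrow> int" where m: "\<And>i. x \<bullet> row i B = 2 * pi * of_int (m i)"
    by (auto simp: choice_iff)
  show "x \<in> scaled_dual (lattice_of B)"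
    unfolding scaled_dual_def
  proof (intro CollectI ballI)
    fix b assume "b \<in> lattice_of B"
    then obtain k :: "_ \<Rightarrow> int" where b: "b = (\<Sum>i\<in>UNIV. of_int (k i) *\<^sub>R row i B)"
      unfolding lattice_of_def by blast
    have "x \<bullet> b = 2 * pi * of_int (\<Sum>i\<in>UNIV. k i * m i)"
      unfolding b by (simp add: inner_sum_right m sum_distrib_left mult_ac)
    then show "\<exists>k::int. x \<bullet> b = 2 * pi * of_int k" by blast
  qed
qed

lemma full_lattice_scaled_dual:
  assumes B: "invertible B"
  shows "full_lattice (scaled_dual (lattice_of B))"
proof -
  define W where "W = (1 / (2 * pi)) *\<^sub>R B"
  have "(W *v x) $ i = x \<bullet> row i B / (2 * pi)" for x i
    by (simp add: W_def scaleR_matrix_vector_assoc[symmetric] matrix_vector_mul_component row_def inner_commute)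
  then have "scaled_dual (lattice_of B) = {x. \<forall>i. \<exists>m::int. (W *v x) $ i = of_int m}"
    by (auto simp: mem_scaled_dual_lattice_of_iff divide_eq_eq mult.commute)
  moreover have "invertible W" using B by (simp add: W_def scalar_invertible)
  ultimately show ?thesis using full_lattice_integer_preimage[of W] by simp
qed

lemma lattice_with_dual_basis_scaled_dual:
  assumes B: "invertible B"
  shows "lattice_with_dual_basis (scaled_dual (lattice_of B)) (lattice_of B) (\<lambda>i. row i B)"
proof -
  interpret B: full_lattice "lattice_of B" by (rule full_lattice_lattice_of) fact
  interpret A: full_lattice "scaled_dual (lattice_of B)" by (rule full_lattice_scaled_dual) fact
  show ?thesis
    by unfold_locales
       (auto simp: B.zero_mem B.uminus_mem B.add_mem row_mem_lattice_of
         mem_scaled_dual_lattice_of_iff[THEN iffD2], auto simp: scaled_dual_def)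
qed

section \<open>Orthogonality of characters on the Voronoi cell\<close>

context full_lattice
begin

text \<open>In the application \<open>L\<close> is the sampling lattice and \<open>A\<close> a set
  of frequencies. Expanding the square gives cosines of differences; off the diagonal they integrate
  to 0, and on it the weights, being 0 or 1, equal their squares.\<close>

lemma nn_integral_cmod_sum_cis_square:
  assumes A: "finite A" and dual: "A \<subseteq> scaled_dual L"
    and a: "\<And>k. k \<in> A \<Longrightarrow> a k = 0 \<or> a k = (1::real)"
  shows "(\<integral>\<^sup>+t. indicator \<Omega> t * ennreal ((cmod (\<Sum>k\<in>A. of_real (a k) * cis (k \<bullet> t)))\<^sup>2) \<partial>lborel)
    = ennreal (measure lborel \<Omega> * (\<Sum>k\<in>A. a k))"
proof -
  have cmod: "(cmod (\<Sum>k\<in>A. of_real (a k) * cis (k \<bullet> t)))\<^sup>2 = (\<Sum>k\<in>A. \<Sum>l\<in>A. a k * a l * cos ((k - l) \<bullet> t))" for t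
  proof -
    have "of_real ((cmod (\<Sum>k\<in>A. of_real (a k) * cis (k \<bullet> t)))\<^sup>2)
        = (\<Sum>k\<in>A. \<Sum>l\<in>A. of_real (a k * a l) * cis ((k - l) \<bullet> t))"
      unfolding cmod_sum_square_eq
      by (intro sum.cong refl) (simp add: cis_cnj cis_mult inner_diff_left mult_ac)
    from arg_cong[OF this, of Re]
    have "(cmod (\<Sum>k\<in>A. of_real (a k) * cis (k \<bullet> t)))\<^sup>2
        = Re (\<Sum>k\<in>A. \<Sum>l\<in>A. of_real (a k * a l) * cis ((k - l) \<bullet> t))"
      by (simp only: Re_complex_of_real)
    then show ?thesis by simp
  qed
  have int: "integrable lborel (\<lambda>t. indicator \<Omega> t * cos (k \<bullet> t))" for k
    by (rule Bochner_Integration.integrable_bound[OF integrable_real_indicator[of \<Omega>]])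
       (use finite_measure_voronoi in \<open>auto simp: indicator_def\<close>)
  have summand: "(\<integral>t. indicator \<Omega> t * cos ((k - l) \<bullet> t) \<partial>lborel) = (if k = l then measure lborel \<Omega> else 0)"
    if "k \<in> A" "l \<in> A" for k l
  proof (cases "k = l")
    case False
    have "\<exists>m::int. (k - l) \<bullet> b = 2 * pi * of_int m" if "b \<in> L" for b
    proof -
      obtain m n :: int where "k \<bullet> b = 2 * pi * of_int m" "l \<bullet> b = 2 * pi * of_int n"
        using dual \<open>k \<in> A\<close> \<open>l \<in> A\<close> \<open>b \<in> L\<close> unfolding scaled_dual_def by blast
      then show ?thesis
        by (intro exI[of _ "m - n"]) (simp add: inner_diff_left algebra_simps)
    qed
    then show ?thesis using integral_cos_voronoi[of "k - l"] False by simp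
  qed simp
  let ?f = "\<lambda>t. \<Sum>k\<in>A. \<Sum>l\<in>A. a k * a l * (indicator \<Omega> t * cos ((k - l) \<bullet> t))"
  have f_eq: "indicator \<Omega> t * (cmod (\<Sum>k\<in>A. of_real (a k) * cis (k \<bullet> t)))\<^sup>2 = ?f t" for t
    unfolding cmod sum_distrib_left by (intro sum.cong refl) simp
  have int2: "integrable lborel (\<lambda>t. a k * a l * (indicator \<Omega> t * cos ((k - l) \<bullet> t)))" for k l
    by (intro integrable_mult_right int)
  have "(\<integral>\<^sup>+t. indicator \<Omega> t * ennreal ((cmod (\<Sum>k\<in>A. of_real (a k) * cis (k \<bullet> t)))\<^sup>2) \<partial>lborel)
    = (\<integral>\<^sup>+t. ennreal (?f t) \<partial>lborel)"
    unfolding f_eq[symmetric]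
    by (intro nn_integral_cong) (simp split: split_indicator)
  also have "\<dots> = ennreal (\<integral>t. ?f t \<partial>lborel)"
    by (intro nn_integral_eq_integral Bochner_Integration.integrable_sum int2)
       (simp add: f_eq[symmetric])
  also have "(\<integral>t. ?f t \<partial>lborel) = (\<Sum>k\<in>A. \<Sum>l\<in>A. a k * a l * (\<integral>t. indicator \<Omega> t * cos ((k - l) \<bullet> t) \<partial>lborel))"
    using int2 by (simp only: Bochner_Integration.integral_sum Bochner_Integration.integrable_sum integral_mult_right_zero)
  also have "\<dots> = (\<Sum>k\<in>A. \<Sum>l\<in>A. if k = l then a k * a k * measure lborel \<Omega> else 0)"
    by (intro sum.cong refl) (simp add: summand)
  also have "\<dots> = (\<Sum>k\<in>A. a k * measure lborel \<Omega>)"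
    using A a by (intro sum.cong refl) (auto simp: sum.delta)
  finally show ?thesis by (simp only: sum_distrib_right[symmetric] mult.commute)
qed

end

section \<open>The interpolation error\<close>

context ball_spectrum
begin

text \<open>Sample combinations and trigonometric polynomials with equal coefficients have errors in
  the fixed ratio \<open>K\<close>, and the projection error and \<open>residual t\<close> are the
  infima of the two. Each inequality is shown up to an arbitrary \<open>e > 0\<close>.\<close>

lemma interpolation_error:
  fixes X :: "real^'n \<Rightarrow> 'a \<Rightarrow> complex"
  assumes X: "\<And>t. square_integrable M (X t)"
    and psd: "has_power_spectral_density M X (\<lambda>x. if x \<in> \<Delta> then S0 else 0)"
    and S0: "S0 > 0"
    and proj: "is_orthogonal_projection M (closed_linear_span M X D) (X t) P"
  shows "(\<integral>w. (cmod (X t w - P w))\<^sup>2 \<partial>M) = S0 / (2 * pi) ^ CARD('n) * enn2real (residual t)"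
proof -
  let ?e = "\<integral>w. (cmod (X t w - P w))\<^sup>2 \<partial>M"
  define K where "K = S0 / (2 * pi) ^ CARD('n)"
  define \<rho> where "\<rho> = enn2real (residual t)"
  have K: "K > 0" using S0 by (simp add: K_def)
  have \<rho>: "residual t = ennreal \<rho>" "\<rho> \<ge> 0"
    using residual_finite[of t] by (auto simp: \<rho>_def)
  \<comment> \<open>The spectral error is exposed as a finite real \<open>v\<close>, so that
    extended and real inequalities can be translated into each other.\<close>
  have trig_error: "\<exists>v\<ge>0. (\<integral>\<^sup>+x. ennreal (indicator \<Delta> x * (cmod (cis (x \<bullet> t) - (\<Sum>b\<in>F. c b * cis (x \<bullet> b))))\<^sup>2) \<partial>lborel) = ennreal v
      \<and> (\<integral>w. (cmod (X t w - (\<Sum>b\<in>F. c b * X b w)))\<^sup>2 \<partial>M) = K * v" if F: "finite F" for F c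
  proof -
    let ?h = "\<lambda>x. indicator \<Delta> x * (cmod (cis (x \<bullet> t) - (\<Sum>b\<in>F. c b * cis (x \<bullet> b))))\<^sup>2"
    have eq: "(if x \<in> \<Delta> then S0 else 0) * (cmod (cis (x \<bullet> t) - (\<Sum>b\<in>F. c b * cis (x \<bullet> b))))\<^sup>2 = S0 * ?h x" for x
      by (simp del: mem_cball)
    have "integrable lborel (\<lambda>x. S0 * ?h x)"
      using spectral_error(2)[OF X psd F, of t c] unfolding eq .
    then have "integrable lborel (\<lambda>x. inverse S0 * (S0 * ?h x))"
      by (rule integrable_mult_right)
    then have h: "integrable lborel ?h" using S0 by (simp add: mult.assoc[symmetric])
    have "(\<integral>w. (cmod (X t w - (\<Sum>b\<in>F. c b * X b w)))\<^sup>2 \<partial>M) = K * (\<integral>x. ?h x \<partial>lborel)"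
      using spectral_error(1)[OF X psd F, of t c] unfolding eq integral_mult_right_zero
      by (simp add: K_def)
    moreover have "(\<integral>\<^sup>+x. ennreal (?h x) \<partial>lborel) = ennreal (\<integral>x. ?h x \<partial>lborel)"
      by (rule nn_integral_eq_integral[OF h]) simp
    moreover have "0 \<le> (\<integral>x. ?h x \<partial>lborel)" by simp
    ultimately show ?thesis by blast
  qed
  have le: "?e \<le> K * \<rho> + e" if "e > 0" for e
  proof -
    \<comment> \<open>The spectral tolerance is \<open>e / K\<close> because passing to the process
      multiplies it by \<open>K\<close>.\<close>
    have "e / K > 0" using K that by simp
    then obtain p where p: "p \<in> trig_polys D" and le: "(\<integral>\<^sup>+x. ennreal (indicator \<Delta> x * (cmod (cis (x \<bullet> t) - p x))\<^sup>2) \<partial>lborel) \<le> residual t + ennreal (e / K)"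
      using trig_poly_error_approx by blast
    obtain F c where F: "finite F" "F \<subseteq> D" "p = (\<lambda>x. \<Sum>b\<in>F. c b * cis (x \<bullet> b))"
      using p by (rule trig_polysE)
    obtain v where v: "v \<ge> 0" "(\<integral>\<^sup>+x. ennreal (indicator \<Delta> x * (cmod (cis (x \<bullet> t) - (\<Sum>b\<in>F. c b * cis (x \<bullet> b))))\<^sup>2) \<partial>lborel) = ennreal v"
      "(\<integral>w. (cmod (X t w - (\<Sum>b\<in>F. c b * X b w)))\<^sup>2 \<partial>M) = K * v"
      using trig_error[OF F(1)] by blast
    have "ennreal v \<le> ennreal (\<rho> + e / K)"
      using le v(2) \<rho> \<open>e / K > 0\<close> unfolding F(3) by (simp add: ennreal_plus)
    then have "v \<le> \<rho> + e / K" using \<rho>(2) \<open>e / K > 0\<close> by (subst (asm) ennreal_le_iff) auto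
    then have "K * v \<le> K * (\<rho> + e / K)" using K by (intro mult_left_mono) auto
    also have "\<dots> = K * \<rho> + e" using K by (simp add: distrib_left)
    finally have "K * v \<le> K * \<rho> + e" .
    moreover have "(\<lambda>w. \<Sum>b\<in>F. c b * X b w) \<in> finite_combinations X D"
      using F unfolding finite_combinations_def by blast
    ultimately show ?thesis
      using projection_error_le[OF X proj, of "\<lambda>w. \<Sum>b\<in>F. c b * X b w"] v(3) by linarith
  qed
  have ge: "K * \<rho> \<le> ?e + e" if "e > 0" for e
  proof -
    obtain Y where Y: "Y \<in> finite_combinations X D" "(\<integral>w. (cmod (X t w - Y w))\<^sup>2 \<partial>M) < ?e + e"
      using projection_error_approx[OF X proj \<open>e > 0\<close>] by blast
    then obtain F c where F: "finite F" "F \<subseteq> D" "Y = (\<lambda>w. \<Sum>b\<in>F. c b * X b w)"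
      unfolding finite_combinations_def by blast
    obtain v where v: "v \<ge> 0" "(\<integral>\<^sup>+x. ennreal (indicator \<Delta> x * (cmod (cis (x \<bullet> t) - (\<Sum>b\<in>F. c b * cis (x \<bullet> b))))\<^sup>2) \<partial>lborel) = ennreal v"
      "(\<integral>w. (cmod (X t w - (\<Sum>b\<in>F. c b * X b w)))\<^sup>2 \<partial>M) = K * v"
      using trig_error[OF F(1)] by blast
    have "ennreal \<rho> \<le> ennreal v"
      using trig_poly_error_ge[OF trig_polysI[OF F(1,2)], of t c] v(2) \<rho>(1) by simp
    then have "K * \<rho> \<le> K * v" using K v(1) by (intro mult_left_mono) auto
    then show ?thesis using Y(2) v(3) unfolding F(3) by linarith
  qed
  have "?e = K * \<rho>"
    by (rule antisym; rule field_le_epsilon) (fact le ge)+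
  then show ?thesis by (simp add: K_def \<rho>_def)
qed

text \<open>The shape of the spectrum, and not just its boundedness, enters here: membership in a
  centred ball depends on the norm alone, so if the shortest point of a coset is outside, the whole
  coset is.\<close>

lemma alias_count_eq_0_iff:
  assumes x: "x \<in> \<Omega>"
  shows "alias_count x = 0 \<longleftrightarrow> x \<notin> \<Delta>"
proof
  assume 0: "alias_count x = 0"
  show "x \<notin> \<Delta>"
  proof
    assume "x \<in> \<Delta>"
    then have "0 \<in> near_points" using not_near_point[OF x zero_mem] by (simp del: mem_cball) blast
    with 0 \<open>x \<in> \<Delta>\<close> show False
      using finite_near_points unfolding alias_count_def
      by (subst (asm) sum_nonneg_eq_0_iff) (auto simp del: mem_cball dest: bspec[of _ _ 0])
  qed
next
  assume "x \<notin> \<Delta>"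
  have "x + l \<notin> \<Delta>" if "l \<in> L" for l
  proof -
    have "norm x \<le> norm (x - (- l))" using x uminus_mem[OF that] unfolding voronoi_cell_def by blast
    then show ?thesis using \<open>x \<notin> \<Delta>\<close> by simp
  qed
  then show "alias_count x = 0"
    using near_points_subset by (auto simp: alias_count_def simp del: mem_cball intro!: sum.neutral)
qed

text \<open>Tonelli puts the time integral inside. For \<open>x\<close> in both cell and ball it is
  \<open>v\<close> times the alias count minus \<open>v\<close>; elsewhere in the cell it is 0.
  Integrating over the cell leaves \<open>v\<close> times the volume of the ball minus that of its
  part in the cell.\<close>

lemma nn_integral_residual:
  assumes D: "full_lattice D" and dual: "L \<subseteq> scaled_dual D"
  shows "(\<integral>\<^sup>+t. indicator (voronoi_cell D) t * residual t \<partial>lborel)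
    = ennreal (measure lborel (voronoi_cell D) * measure lborel (\<Delta> - \<Omega>))"
proof -
  interpret D: full_lattice D by fact
  let ?V = "voronoi_cell D"
  define v where "v = measure lborel ?V"
  have v: "v > 0" "emeasure lborel ?V = ennreal v"
    using D.measure_voronoi_pos D.finite_measure_voronoi
    by (auto simp: v_def emeasure_eq_ennreal_measure less_top)
  let ?r = "\<lambda>t x. alias_count x - (cmod (alias_sum t x))\<^sup>2 / alias_count x"
  let ?I = "\<lambda>x. \<integral>\<^sup>+t. indicator ?V t * ennreal (?r t x) \<partial>lborel"
  have [measurable]: "\<Delta> \<in> sets borel" by simp
  have [measurable]: "(\<lambda>t. alias_sum t x) \<in> borel_measurable borel" for x
    unfolding alias_sum_def by measurable
  \<comment> \<open>The subtracted term is moved to the left, since subtraction of extended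
    nonnegative numbers truncates at 0.\<close>
  have inner: "?I x + ennreal v * indicator \<Delta> x = ennreal v * ennreal (alias_count x)" if x: "x \<in> \<Omega>" for x
  proof (cases "x \<in> \<Delta>")
    case False
    then have "alias_count x = 0" using alias_count_eq_0_iff[OF x] by simp
    then show ?thesis using False by simp
  next
    case True
    then have n: "alias_count x > 0"
      using alias_count_eq_0_iff[OF x] alias_count_nonneg[of x] by (simp del: mem_cball)
    \<comment> \<open>Orthogonality gives \<open>v\<close> times the alias count for the integrated
      square, and the division by that count leaves \<open>v\<close>.\<close>
    have "(\<integral>\<^sup>+t. indicator ?V t * ennreal ((cmod (alias_sum t x))\<^sup>2 / alias_count x) \<partial>lborel)
       = (\<integral>\<^sup>+t. ennreal (1 / alias_count x) * (indicator ?V t * ennreal ((cmod (alias_sum t x))\<^sup>2)) \<partial>lborel)"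
      using n by (intro nn_integral_cong) (auto simp: ennreal_mult'[symmetric] split: split_indicator)
    also have "\<dots> = ennreal (1 / alias_count x) * (\<integral>\<^sup>+t. (indicator ?V t * ennreal ((cmod (alias_sum t x))\<^sup>2)) \<partial>lborel)"
      by (rule nn_integral_cmult) measurable
    also have "(\<integral>\<^sup>+t. (indicator ?V t * ennreal ((cmod (alias_sum t x))\<^sup>2)) \<partial>lborel) = ennreal (v * alias_count x)"
      unfolding alias_sum_def alias_count_def v_def
      using dual near_points_subset
      by (intro D.nn_integral_cmod_sum_cis_square finite_near_points) (auto simp: indicator_def)
    also have "ennreal (1 / alias_count x) * \<dots> = ennreal v"
      using n v by (simp add: ennreal_mult'[symmetric])
    finally have "(\<integral>\<^sup>+t. indicator ?V t * ennreal ((cmod (alias_sum t x))\<^sup>2 / alias_count x) \<partial>lborel) = ennreal v" .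
    then have "?I x + ennreal v = ?I x + (\<integral>\<^sup>+t. indicator ?V t * ennreal ((cmod (alias_sum t x))\<^sup>2 / alias_count x) \<partial>lborel)"
      by simp
    also have "\<dots> = (\<integral>\<^sup>+t. indicator ?V t * ennreal (?r t x) + indicator ?V t * ennreal ((cmod (alias_sum t x))\<^sup>2 / alias_count x) \<partial>lborel)"
      by (rule nn_integral_add[symmetric]) measurable
    also have "\<dots> = (\<integral>\<^sup>+t. indicator ?V t * ennreal (alias_count x) \<partial>lborel)"
    proof (rule nn_integral_cong)
      fix t
      have "ennreal (?r t x) + ennreal ((cmod (alias_sum t x))\<^sup>2 / alias_count x) = ennreal (alias_count x)"
        using n residual_integrand(1)[of x t] by (subst ennreal_plus[symmetric]) auto
      then show "indicator ?V t * ennreal (?r t x) + indicator ?V t * ennreal ((cmod (alias_sum t x))\<^sup>2 / alias_count x)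
          = indicator ?V t * ennreal (alias_count x)"
        by (simp add: distrib_left[symmetric])
    qed
    also have "\<dots> = ennreal v * ennreal (alias_count x)"
      using v by (subst nn_integral_multc) auto
    finally show ?thesis using True by simp
  qed
  let ?T = "\<integral>\<^sup>+t. indicator ?V t * residual t \<partial>lborel"
  have "?T = (\<integral>\<^sup>+t. (\<integral>\<^sup>+x. indicator ?V t * (indicator \<Omega> x * ennreal (?r t x)) \<partial>lborel) \<partial>lborel)"
    unfolding residual_def by (intro nn_integral_cong nn_integral_cmult[symmetric]) measurable
  also have "\<dots> = (\<integral>\<^sup>+x. (\<integral>\<^sup>+t. indicator ?V t * (indicator \<Omega> x * ennreal (?r t x)) \<partial>lborel) \<partial>lborel)"
    by (rule lborel_pair.Fubini') measurable
  also have "\<dots> = (\<integral>\<^sup>+x. indicator \<Omega> x * ?I x \<partial>lborel)"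
    by (intro nn_integral_cong) (auto split: split_indicator)
  finally have T: "?T = (\<integral>\<^sup>+x. indicator \<Omega> x * ?I x \<partial>lborel)" .
  have "?T + ennreal v * emeasure lborel (\<Delta> \<inter> \<Omega>)
      = ?T + (\<integral>\<^sup>+x. ennreal v * indicator (\<Delta> \<inter> \<Omega>) x \<partial>lborel)"
    by (subst nn_integral_cmult_indicator) auto
  also have "\<dots> = (\<integral>\<^sup>+x. indicator \<Omega> x * ?I x + ennreal v * indicator (\<Delta> \<inter> \<Omega>) x \<partial>lborel)"
    unfolding T by (rule nn_integral_add[symmetric]) measurable
  also have "\<dots> = (\<integral>\<^sup>+x. ennreal v * (indicator \<Omega> x * ennreal (alias_count x)) \<partial>lborel)"
  proof (rule nn_integral_cong)
    fix x
    show "indicator \<Omega> x * ?I x + ennreal v * indicator (\<Delta> \<inter> \<Omega>) x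
        = ennreal v * (indicator \<Omega> x * ennreal (alias_count x))"
    proof (cases "x \<in> \<Omega>")
      case True
      then have "indicator (\<Delta> \<inter> \<Omega>) x = (indicator \<Delta> x :: ennreal)" by (simp add: indicator_def)
      then show ?thesis using inner[OF True] True by (simp del: mem_cball)
    qed simp
  qed
  also have "\<dots> = ennreal v * emeasure lborel \<Delta>"
    unfolding nn_integral_alias_count[symmetric] by (rule nn_integral_cmult) measurable
  also have "emeasure lborel \<Delta> = emeasure lborel (\<Delta> - \<Omega>) + emeasure lborel (\<Delta> \<inter> \<Omega>)"
    by (subst plus_emeasure) (auto intro!: arg_cong[where f="emeasure lborel"])
  finally have "ennreal v * emeasure lborel (\<Delta> \<inter> \<Omega>) + ?T
      = ennreal v * emeasure lborel (\<Delta> \<inter> \<Omega>) + ennreal v * emeasure lborel (\<Delta> - \<Omega>)"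
    by (simp add: distrib_left add.commute)
  \<comment> \<open>Finiteness is what permits cancelling the common summand.\<close>
  moreover have "emeasure lborel (\<Delta> \<inter> \<Omega>) < \<infinity>" "emeasure lborel (\<Delta> - \<Omega>) < \<infinity>"
    by (rule emeasure_bounded_finite, rule bounded_subset[OF bounded_cball[of 0 \<omega>0]], blast)+
  ultimately have "?T = ennreal v * emeasure lborel (\<Delta> - \<Omega>)"
    by (subst (asm) ennreal_add_left_cancel) (auto simp: ennreal_mult_eq_top_iff)
  then show ?thesis
    using v \<open>emeasure lborel (\<Delta> - \<Omega>) < \<infinity>\<close>
    by (simp add: v_def ennreal_mult' emeasure_eq_ennreal_measure less_top)
qed

end

theorem theorem1:
  fixes B :: "real^'n^'n"
    and M :: "'a measure"
    and X Xhat :: "real^'n \<Rightarrow> 'a \<Rightarrow> complex"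
    and \<omega>0 S0 :: real
    and \<Delta> :: "(real^'n) set"
    and t :: "real^'n"
  assumes "invertible B"
    and "\<omega>0 > 0" and "S0 > 0"
    and "\<Delta> = {\<omega>. norm \<omega> \<le> \<omega>0}"
    and "prob_space M"
    and "\<And>t. square_integrable M (X t)"
    and "zero_mean M X"
    and "wide_sense_stationary M X"
    and "has_power_spectral_density M X (\<lambda>\<omega>. if \<omega> \<in> \<Delta> then S0 else 0)"
    and "best_linear_interpolator M X (lattice_of B) Xhat"
  shows "average_error_variance M (lattice_of B) X Xhat =
    complex_variance M (X t) *
      (measure lebesgue (\<Delta> - voronoi_cell (scaled_dual (lattice_of B))) / measure lebesgue \<Delta>)"
proof -
  let ?L = "lattice_of B"
  interpret D: full_lattice ?L by (rule full_lattice_lattice_of) fact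
  interpret A: lattice_with_dual_basis "scaled_dual ?L" ?L "\<lambda>i. row i B"
    by (rule lattice_with_dual_basis_scaled_dual) fact
  interpret A: ball_spectrum "scaled_dual ?L" ?L "\<lambda>i. row i B" \<omega>0 ..
  note X = assms(6)
  have \<Delta>: "\<Delta> = cball 0 \<omega>0" using assms(4) by auto
  define K where "K = S0 / (2 * pi) ^ CARD('n)"
  have K: "K > 0" using assms(3) by (simp add: K_def)
  define v where "v = measure lborel (voronoi_cell ?L)"
  have v: "v > 0" unfolding v_def by (rule D.measure_voronoi_pos)
  have psd: "has_power_spectral_density M X (\<lambda>x. if x \<in> cball 0 \<omega>0 then S0 else 0)"
    using assms(9) unfolding \<Delta> .
  have [measurable]: "\<Delta> \<in> sets borel" by (simp add: \<Delta>)
  have error: "(\<integral>w. (cmod (X t w - Xhat t w))\<^sup>2 \<partial>M) = K * enn2real (A.residual t)" for t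
    using A.interpolation_error[OF X psd assms(3)] assms(10)
    by (simp add: K_def best_linear_interpolator_def)
  \<comment> \<open>After rewriting by \<open>error\<close> the integrand is Borel in
    \<open>t\<close>, whichever versions of the projections make up \<open>Xhat\<close>; so the
    completed measure can be replaced by \<open>lborel\<close>.\<close>
  have "(LINT t:voronoi_cell ?L|lebesgue. (\<integral>w. (cmod (X t w - Xhat t w))\<^sup>2 \<partial>M))
      = (\<integral>t. indicator (voronoi_cell ?L) t * (K * enn2real (A.residual t)) \<partial>lborel)"
    unfolding set_lebesgue_integral_def error real_scaleR_def
    by (rule integral_completion) measurable
  also have "\<dots> = enn2real (\<integral>\<^sup>+t. ennreal (indicator (voronoi_cell ?L) t * (K * enn2real (A.residual t))) \<partial>lborel)"
    using K by (intro integral_eq_nn_integral) auto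
  also have "(\<integral>\<^sup>+t. ennreal (indicator (voronoi_cell ?L) t * (K * enn2real (A.residual t))) \<partial>lborel)
      = (\<integral>\<^sup>+t. ennreal K * (indicator (voronoi_cell ?L) t * A.residual t) \<partial>lborel)"
    using K A.residual_finite
    by (intro nn_integral_cong) (auto simp: ennreal_mult' less_top split: split_indicator)
  also have "\<dots> = ennreal K * ennreal (v * measure lborel (\<Delta> - voronoi_cell (scaled_dual ?L)))"
    unfolding v_def \<Delta> A.nn_integral_residual[OF D.full_lattice_axioms subset_refl, symmetric]
    by (rule nn_integral_cmult) measurable
  also have "enn2real \<dots> = K * (v * measure lborel (\<Delta> - voronoi_cell (scaled_dual ?L)))"
    using K v by (simp add: ennreal_mult'[symmetric])
  finally have avg: "average_error_variance M ?L X Xhat = K * measure lborel (\<Delta> - voronoi_cell (scaled_dual ?L))"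
    using v by (simp add: average_error_variance_def v_def)
  have "complex_variance M (X t) = (\<integral>w. (cmod (X t w))\<^sup>2 \<partial>M)"
    using assms(7) by (simp add: complex_variance_def zero_mean_def)
  \<comment> \<open>The isometry for a single point with coefficient 1, where the character has
    modulus 1.\<close>
  also have "\<dots> = 1 / (2 * pi) ^ CARD('n) * (\<integral>x. (if x \<in> \<Delta> then S0 else 0) \<partial>lborel)"
    using spectral_isometry(1)[OF X assms(9), of "\<lambda>_. 1" "\<lambda>_. t" "{()}"] by simp
  also have "(\<integral>x. (if x \<in> \<Delta> then S0 else 0) \<partial>lborel) = (\<integral>x. S0 * indicator \<Delta> x \<partial>lborel)"
    by (intro Bochner_Integration.integral_cong) auto
  also have "\<dots> = S0 * measure lborel \<Delta>" by simp
  finally have var: "complex_variance M (X t) = K * measure lborel \<Delta>" by (simp add: K_def)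
  \<comment> \<open>Positivity lets the volume of the ball cancel between the variance and the
    quotient.\<close>
  have "measure lborel \<Delta> > 0"
    using content_cball_pos[OF assms(2), of "0 :: real^'n"] by (simp add: \<Delta>)
  then show ?thesis
    unfolding avg var by simp
qed

end
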